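(* For each positive integer $d$, let $P_s(d)$ be the probability that a $d\times d$ matrix chosen uniformly at random from $\{0,1\}^{d\times d}$ is singular (over $\mathbb{R}$). Let $\mathcal{G}$ be the set of all linearly independent sets of $d-1$ vectors in $\{0,1\}^d\subset\mathbb{R}^d$, for a set $S$ of vectors let $v(S)$ be the number of vectors of $\{0,1\}^d$ in the linear span of $S$, and let \[E(d)=\frac{1}{|\mathcal{G}|}\sum_{G\in\mathcal{G}} v(G).\] Then, as $d\to\infty$, \[P_s(d)=\left(\frac{1}{2^d}E(d)+\frac{d^2}{2^{d+1}}\right)(1+o(1)).\]
   Context: $E(d)$ is the expected number of $0/1$-vectors in the hyperplane (through the origin) spanned by a uniformly random linearly independent $(d-1)$-set of $0/1$-vectors of length $d$. The notation $f(d)=g(d)(1+o(1))$ means $f(d)/g(d)\to 1$ as $d\to\infty$. *)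

theory Defs
  imports "HOL-Probability.Probability_Mass_Function" "Jordan_Normal_Form.VS_Connect"
begin

definition zero_one_vecs :: "nat \<Rightarrow> real vec set" where
  "zero_one_vecs d = {v \<in> carrier_vec d. \<forall>i<d. v $ i \<in> {0, 1}}"

definition zero_one_mats :: "nat \<Rightarrow> real mat set" where
  "zero_one_mats d = {A \<in> carrier_mat d d. \<forall>i<d. \<forall>j<d. A $$ (i, j) \<in> {0, 1}}"

definition singular_mat :: "real mat \<Rightarrow> bool" where
  "singular_mat A \<longleftrightarrow> \<not> invertible_mat A"

definition P_s :: "nat \<Rightarrow> real" where
  "P_s d = measure_pmf.prob (pmf_of_set (zero_one_mats d)) {A. singular_mat A}"

abbreviation real_span :: "nat \<Rightarrow> real vec set \<Rightarrow> real vec set" where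
  "real_span d \<equiv> LinearCombinations.module.span class_ring (module_vec TYPE(real) d)"

abbreviation real_lin_indpt :: "nat \<Rightarrow> real vec set \<Rightarrow> bool" where
  "real_lin_indpt d S \<equiv> \<not> LinearCombinations.module.lin_dep class_ring (module_vec TYPE(real) d) S"

definition lin_indpt_sets :: "nat \<Rightarrow> real vec set set" where
  "lin_indpt_sets d = {S. S \<subseteq> zero_one_vecs d \<and> card S = d - 1 \<and> real_lin_indpt d S}"

definition num_spanned :: "nat \<Rightarrow> real vec set \<Rightarrow> nat" where
  "num_spanned d S = card (zero_one_vecs d \<inter> real_span d S)"

definition expected_spanned :: "nat \<Rightarrow> real" where
  "expected_spanned d = (1 / real (card (lin_indpt_sets d))) * (\<Sum>G\<in>lin_indpt_sets d. real (num_spanned d G))"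

end

theory Submission
  imports Defs "HOL-Real_Asymp.Real_Asymp"
begin

text \<open>
  Let \<open>p\<close> be the probability that the first \<open>d - 1\<close> columns are dependent, so that
  \<open>P_s d = p + (1 - p) * E(d) / 2 ^ d\<close>. It has to be shown that \<open>p\<close> is \<open>d\<^sup>2 / 2 ^ (d + 1)\<close> up to a
  factor \<open>1 + o(1)\<close> and an error \<open>o(P_s d)\<close>.

  A zero column or two equal columns occur with probability asymptotic to \<open>d\<^sup>2 / 2 ^ (d + 1)\<close>.
  A relation whose support has \<open>k \<ge> 3\<close> elements is determined by \<open>k - 1\<close> of the rows, and each of the
  other rows satisfies it with probability at most \<open>(k choose (k div 2)) / 2 ^ k\<close> by the
  Littlewood--Offord theorem; for \<open>k \<le> (1 - \<delta>) * d\<close> the union bound gives \<open>o(2 ^ -d)\<close>.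

  In the remaining case all relations between the first \<open>d - 1\<close> columns have support larger than
  \<open>(1 - \<delta>) * d\<close>. With probability at least \<open>1 / 2\<close> the last column is then outside the span of the
  others, that is, it is a coloop of the singular matrix. Such a matrix has at most \<open>\<delta> * d\<close> coloops, so
  by the symmetry of the columns this happens with probability at most \<open>\<delta> * P_s d\<close>.
\<close>

section \<open>The Littlewood--Offord bound\<close>

text \<open>\<open>2 ^ k * lo_bound k r\<close> is the sum of the \<open>r\<close> largest binomial coefficients \<open>k choose i\<close>.\<close>

fun lo_bound :: "nat \<Rightarrow> nat \<Rightarrow> real" where
  "lo_bound 0 r = (if r = 0 then 0 else 1)"
| "lo_bound (Suc k) r = (if r = 0 then 0 else (lo_bound k (r + 1) + lo_bound k (r - 1)) / 2)"

lemma lo_bound_0_right [simp]: "lo_bound k 0 = 0"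
  by (cases k) auto

lemma lo_bound_nonneg: "0 \<le> lo_bound k r"
  by (induction k r rule: lo_bound.induct) auto

lemma lo_bound_le_1: "lo_bound k r \<le> 1"
proof (induction k arbitrary: r)
  case (Suc k)
  from Suc[of "r + 1"] Suc[of "r - 1"] show ?case by auto
qed auto

text \<open>The recursion averages the two neighbours of \<open>r\<close>, so concavity passes from
  \<open>k\<close> to \<open>Suc k\<close> by averaging two instances; for \<open>r = 0\<close> the
  instance at 1 suffices because the value at 0 is 0.\<close>

lemma lo_bound_concave: "lo_bound k r + lo_bound k (r + 2) \<le> 2 * lo_bound k (r + 1)"
proof (induction k arbitrary: r)
  case (Suc k)
  show ?case
  proof (cases r)
    case 0
    then show ?thesis using Suc[of 1] by (simp add: numeral_eq_Suc)
  next
    case (Suc q)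
    then show ?thesis using Suc.IH[of q] Suc.IH[of "q + 2"]
      by (simp add: numeral_eq_Suc add_divide_distrib)
  qed
qed auto

text \<open>By the recursion the new value is the mean of the two neighbours, which concavity bounds
  by the middle value.\<close>

lemma lo_bound_decreasing: "lo_bound (Suc k) r \<le> lo_bound k r"
proof (cases r)
  case (Suc q)
  then show ?thesis using lo_bound_concave[of k q] by simp
qed auto

lemma lo_bound_antimono: "k \<le> l \<Longrightarrow> lo_bound l r \<le> lo_bound k r"
  by (rule lift_Suc_antimono_le[of "\<lambda>k. lo_bound k r"]) (rule lo_bound_decreasing)

lemma lo_bound_increment_antimono:
  "lo_bound k (r + m + 1) - lo_bound k (r + m) \<le> lo_bound k (r + 1) - lo_bound k r"
proof (induction m)
  case (Suc m)
  then show ?case using lo_bound_concave[of k "r + m"] by (simp add: numeral_eq_Suc)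
qed auto

text \<open>For a concave sequence, moving two arguments with a fixed sum further apart does not
  raise the sum of the values. The pair \<open>r + 1\<close>, \<open>r - 1\<close> is the one in the
  recursion, and \<open>m + 1 \<le> r\<close> keeps the subtraction exact.\<close>

lemma lo_bound_spread:
  assumes "m + 1 \<le> r"
  shows "lo_bound k (r + 1 + m) + lo_bound k (r - 1 - m)
    \<le> lo_bound k (r + 1) + lo_bound k (r - 1)"
  using assms
proof (induction m)
  case (Suc m)
  define q where "q = r - 2 - m"
  have q: "r - 1 - m = q + 1" "r - 1 - Suc m = q" "r + 1 + m = q + (2 * m + 3)"
      "r + 1 + Suc m = q + (2 * m + 3) + 1"
    using Suc.prems by (auto simp: q_def)
  have "lo_bound k (q + (2 * m + 3) + 1) - lo_bound k (q + (2 * m + 3))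
      \<le> lo_bound k (q + 1) - lo_bound k q"
    by (rule lo_bound_increment_antimono)
  moreover have "lo_bound k (r + 1 + m) + lo_bound k (r - 1 - m)
      \<le> lo_bound k (r + 1) + lo_bound k (r - 1)"
    using Suc.IH Suc.prems by simp
  ultimately show ?case unfolding q by linarith
qed auto

lemma lo_bound_1_1: "lo_bound 1 1 = 1 / 2"
  by simp

lemma lo_bound_3_1: "lo_bound 3 1 = 3 / 8"
  by (simp add: numeral_eq_Suc)

text \<open>The pointwise limit of the bounds is harmonic, vanishes at 0 and is bounded, hence it is 0.\<close>

lemma lo_bound_tendsto_0: "(\<lambda>k. lo_bound k 1) \<longlonglongrightarrow> 0"
proof -
  have "\<exists>L. (\<lambda>k. lo_bound k r) \<longlonglongrightarrow> L" for r
  proof -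
    have "convergent (\<lambda>k. lo_bound k r)"
    proof (rule Bseq_monoseq_convergent)
      show "Bseq (\<lambda>k. lo_bound k r)"
        by (rule BseqI'[where K = 1]) (use lo_bound_nonneg lo_bound_le_1 in auto)
      show "monoseq (\<lambda>k. lo_bound k r)"
        by (rule decseq_imp_monoseq) (auto simp: decseq_def lo_bound_antimono)
    qed
    then show ?thesis by (auto simp: convergent_def)
  qed
  then obtain h where h: "\<And>r. (\<lambda>k. lo_bound k r) \<longlonglongrightarrow> h r" by metis
  have h0: "h 0 = 0" using h[of 0] by (simp add: LIMSEQ_const_iff)
  have harm: "h (r + 2) = 2 * h (r + 1) - h r" for r
  proof -
    have "(\<lambda>k. (lo_bound k (r + 2) + lo_bound k r) / 2) \<longlonglongrightarrow> (h (r + 2) + h r) / 2"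
      by (intro tendsto_intros h) auto
    moreover have "(\<lambda>k. (lo_bound k (r + 2) + lo_bound k r) / 2) = (\<lambda>k. lo_bound (Suc k) (r + 1))"
      by (auto simp: numeral_eq_Suc)
    moreover have "(\<lambda>k. lo_bound (Suc k) (r + 1)) \<longlonglongrightarrow> h (r + 1)"
      using h[of "r + 1"] by (rule LIMSEQ_Suc)
    ultimately have "(h (r + 2) + h r) / 2 = h (r + 1)" by (metis LIMSEQ_unique)
    then show ?thesis by simp
  qed
  have lin: "h r = real r * h 1 \<and> h (Suc r) = real (Suc r) * h 1" for r
  proof (induction r)
    case (Suc r)
    then show ?case using harm[of r] by (simp add: algebra_simps)
  qed (use h0 in auto)
  have h1: "0 \<le> h 1" by (rule LIMSEQ_le_const[OF h]) (auto intro: lo_bound_nonneg)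
  have le1: "h r \<le> 1" for r by (rule LIMSEQ_le_const2[OF h]) (auto intro: lo_bound_le_1)
  have "h 1 = 0"
  proof (rule ccontr)
    assume "h 1 \<noteq> 0"
    then have "h 1 > 0" using h1 by simp
    then obtain r where "1 < real r * h 1" using reals_Archimedean3 by blast
    with le1[of r] lin[of r] show False by simp
  qed
  with h[of 1] show ?thesis by simp
qed

section \<open>Counting functions by splitting off one coordinate\<close>

lemma card_PiE_insert_Collect:
  assumes "finite N" "finite A" "a \<notin> N"
  shows "card {x \<in> insert a N \<rightarrow>\<^sub>E A. P x} = (\<Sum>x \<in> N \<rightarrow>\<^sub>E A. card {y \<in> A. P (x(a := y))})"
proof -
  have "bij_betw (\<lambda>(x, y). x(a := y)) (SIGMA x:N \<rightarrow>\<^sub>E A. {y \<in> A. P (x(a := y))})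
      {x \<in> insert a N \<rightarrow>\<^sub>E A. P x}"
  proof (rule bij_betwI[where g = "\<lambda>x. (restrict x N, x a)"], goal_cases)
    case 1
    show ?case by (auto simp: PiE_def extensional_def)
  next
    case 2
    have "(restrict x N)(a := x a) = x" if "x \<in> insert a N \<rightarrow>\<^sub>E A" for x
      using that by (auto simp: fun_eq_iff PiE_def extensional_def restrict_def)
    then show ?case by (auto simp: PiE_def)
  next
    case (3 z)
    then show ?case using assms(3)
      by (auto simp: fun_eq_iff PiE_def extensional_def restrict_def)
  next
    case (4 x)
    then show ?case
      by (auto simp: fun_eq_iff PiE_def extensional_def restrict_def)
  qed
  then have "card {x \<in> insert a N \<rightarrow>\<^sub>E A. P x} = card (SIGMA x:N \<rightarrow>\<^sub>E A. {y \<in> A. P (x(a := y))})"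
    by (simp add: bij_betw_same_card)
  also have "\<dots> = (\<Sum>x \<in> N \<rightarrow>\<^sub>E A. card {y \<in> A. P (x(a := y))})"
    using assms by (intro card_SigmaI finite_PiE) auto
  finally show ?thesis .
qed

text \<open>The order of summation is exchanged, so that the outer sum runs over the values of the
  new coordinate; for the values 0 and 1 these are the two terms of the Littlewood-Offord
  induction.\<close>

lemma card_PiE_insert_Collect':
  fixes A :: "'b set" and N :: "'a set"
  assumes "finite N" "finite A" "a \<notin> N"
  shows "card {x \<in> insert a N \<rightarrow>\<^sub>E A. P x} = (\<Sum>y\<in>A. card {x \<in> N \<rightarrow>\<^sub>E A. P (x(a := y))})"
proof -
  have count: "card {z \<in> B. Q z} = (\<Sum>z\<in>B. if Q z then 1 else 0)" if "finite B" for B :: "'b set" and Q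
    using that by (simp add: sum.If_cases Int_def conj_commute)
  have count': "card {z \<in> B. Q z} = (\<Sum>z\<in>B. if Q z then 1 else 0)" if "finite B" for B :: "('a \<Rightarrow> 'b) set" and Q
    using that by (simp add: sum.If_cases Int_def conj_commute)
  have fin: "finite (N \<rightarrow>\<^sub>E A)" using assms by (simp add: finite_PiE)
  show ?thesis
    unfolding card_PiE_insert_Collect[OF assms] count[OF assms(2)] count'[OF fin] by (rule sum.swap)
qed

text \<open>With one more nonzero coefficient \<open>c\<close> the target set \<open>X\<close> is replaced by the pair
  of \<open>X\<close> and its translate \<open>Y\<close> by \<open>-c\<close>, or equally by \<open>X \<union> Y\<close> and \<open>X \<inter> Y\<close>; since \<open>X \<noteq> Y\<close>, the
  cardinalities of the latter are spread out and concavity applies.\<close>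

lemma littlewood_offord:
  fixes \<alpha> :: "'a \<Rightarrow> real"
  assumes "finite N" "finite X"
  shows "card {x \<in> N \<rightarrow>\<^sub>E {0, 1}. (\<Sum>j\<in>N. \<alpha> j * x j) \<in> X}
    \<le> lo_bound (card {j \<in> N. \<alpha> j \<noteq> 0}) (card X) * 2 ^ card N"
  using assms
proof (induction N arbitrary: X rule: finite_induct)
  case empty
  have "card {x \<in> {} \<rightarrow>\<^sub>E {0, 1 :: real}. (\<Sum>j\<in>({} :: 'a set). \<alpha> j * x j) \<in> X}
      \<le> card ({} \<rightarrow>\<^sub>E {0, 1 :: real} :: ('a \<Rightarrow> real) set)"
    by (rule card_mono) auto
  then show ?case using empty by (auto simp: card_eq_0_iff)
next
  case (insert a N)
  define c where "c = \<alpha> a"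
  define Y where "Y = (\<lambda>t. t - c) ` X"
  define cnt where "cnt Z = card {x \<in> N \<rightarrow>\<^sub>E {0, 1}. (\<Sum>j\<in>N. \<alpha> j * x j) \<in> Z}" for Z
  define k where "k = card {j \<in> N. \<alpha> j \<noteq> 0}"
  have sum0: "(\<Sum>j\<in>N. \<alpha> j * (if j = a then y else x j)) = (\<Sum>j\<in>N. \<alpha> j * x j)" for x y
    using insert by (intro sum.cong) auto
  have Y: "t \<in> Y \<longleftrightarrow> c + t \<in> X" for t
    by (force simp: Y_def image_iff)
  have fin: "finite Y" "card Y = card X"
    unfolding Y_def using insert by (auto intro!: card_image simp: inj_on_def)
  have IH: "cnt Z \<le> lo_bound k (card Z) * 2 ^ card N" if "finite Z" for Z
    using insert.IH[OF that] by (simp add: cnt_def k_def)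
  have "card {x \<in> insert a N \<rightarrow>\<^sub>E {0, 1}. (\<Sum>j\<in>insert a N. \<alpha> j * x j) \<in> X} = cnt X + cnt Y"
    using insert(1,2) by (subst card_PiE_insert_Collect') (auto simp: sum0 cnt_def Y c_def)
  moreover have "cnt X + cnt Y \<le> lo_bound (card {j \<in> insert a N. \<alpha> j \<noteq> 0}) (card X) * 2 ^ card (insert a N)"
  proof (cases "c = 0")
    case True
    then have "X = Y" by (auto simp: Y)
    moreover have "{j \<in> insert a N. \<alpha> j \<noteq> 0} = {j \<in> N. \<alpha> j \<noteq> 0}" using True by (auto simp: c_def)
    ultimately show ?thesis using IH[OF insert(4)] insert(1,2) by (simp add: k_def)
  next
    case False
    have "{j \<in> insert a N. \<alpha> j \<noteq> 0} = insert a {j \<in> N. \<alpha> j \<noteq> 0}" using False by (auto simp: c_def)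
    then have k: "card {j \<in> insert a N. \<alpha> j \<noteq> 0} = Suc k" using insert(1,2) by (simp add: k_def)
    show ?thesis
    proof (cases "X = {}")
      case True
      then show ?thesis by (simp add: cnt_def Y_def)
    next
      case ne: False
      \<comment> \<open>A nonempty finite set is not invariant under a nonzero translation: adding
        \<open>c\<close> to its maximum (if \<open>c > 0\<close>) or its minimum (if
        \<open>c < 0\<close>) leaves the set.\<close>
      have "X \<noteq> Y"
      proof
        assume eq: "X = Y"
        have "Max X + c \<in> X" if "c > 0"
          using Y[of "Max X"] eq ne insert(4) by (simp add: add.commute)
        then have "\<not> c > 0" using Max_ge[OF insert(4), of "Max X + c"] by auto
        moreover have "Min X + c \<in> X"
          using Y[of "Min X"] eq ne insert(4) by (simp add: add.commute)
        then have "\<not> c < 0" using Min_le[OF insert(4), of "Min X + c"] by auto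
        ultimately show False using False by simp
      qed
      define r where "r = card X"
      have "card (X \<union> Y) > r"
      proof -
        have "X \<subset> X \<union> Y" using \<open>X \<noteq> Y\<close> fin insert(4) card_subset_eq[of X Y] by auto
        then show ?thesis unfolding r_def using fin insert(4) by (intro psubset_card_mono) auto
      qed
      then obtain m where m: "card (X \<union> Y) = r + 1 + m" by (auto simp: less_iff_Suc_add)
      have ui: "card (X \<union> Y) + card (X \<inter> Y) = 2 * r"
        using card_Un_Int[OF insert(4) fin(1)] fin by (simp add: r_def)
      have le: "m + 1 \<le> r" using m ui by linarith
      have i: "card (X \<inter> Y) = r - 1 - m" using m ui by linarith
      have "cnt X + cnt Y = cnt (X \<union> Y) + cnt (X \<inter> Y)"
      proof -
        define F where "F Z = {x \<in> N \<rightarrow>\<^sub>E {0, 1}. (\<Sum>j\<in>N. \<alpha> j * x j) \<in> Z}" for Z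
        have "finite (F Z)" for Z
          using finite_PiE[OF insert(1), of "\<lambda>_. {0, 1 :: real}"] by (simp add: F_def)
        moreover have "F (X \<union> Y) = F X \<union> F Y" "F (X \<inter> Y) = F X \<inter> F Y" by (auto simp: F_def)
        ultimately show ?thesis using card_Un_Int[of "F X" "F Y"] by (simp add: cnt_def F_def)
      qed
      then have "real (cnt X + cnt Y) \<le> lo_bound k (card (X \<union> Y)) * 2 ^ card N + lo_bound k (card (X \<inter> Y)) * 2 ^ card N"
        using IH[of "X \<union> Y"] IH[of "X \<inter> Y"] fin insert(4) by simp
      also have "\<dots> = (lo_bound k (r + 1 + m) + lo_bound k (r - 1 - m)) * 2 ^ card N"
        by (simp add: m i algebra_simps)
      also have "\<dots> \<le> (lo_bound k (r + 1) + lo_bound k (r - 1)) * 2 ^ card N"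
        by (intro mult_right_mono lo_bound_spread le) auto
      also have "\<dots> = lo_bound (Suc k) r * 2 ^ Suc (card N)"
        using le by simp
      finally show ?thesis using insert(1,2) unfolding k r_def by (simp del: lo_bound.simps)
    qed
  qed
  ultimately show ?case by simp
qed

section \<open>Kernel vectors with a given support\<close>

text \<open>Row rank is at most the number of columns, by Gaussian elimination. A column that
  vanishes on \<open>I\<close> is dropped; otherwise a row with a nonzero entry in that column joins
  \<open>R\<close> as pivot and the reduced rows go into the induction.\<close>

lemma determining_rows:
  fixes M :: "'i \<Rightarrow> 'j \<Rightarrow> real"
  assumes "finite J"
  shows "\<exists>R\<subseteq>I. finite R \<and> card R \<le> card J \<and>
    (\<forall>x. (\<forall>i\<in>R. (\<Sum>j\<in>J. M i j * x j) = 0) \<longrightarrow> (\<forall>i\<in>I. (\<Sum>j\<in>J. M i j * x j) = 0))"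
  using assms
proof (induction J arbitrary: M rule: finite_induct)
  case empty
  show ?case by (rule exI[of _ "{}"]) auto
next
  case (insert a J)
  show ?case
  proof (cases "\<forall>i\<in>I. M i a = 0")
    case True
    obtain R where R: "R \<subseteq> I" "finite R" "card R \<le> card J"
      "\<And>x i. (\<forall>i\<in>R. (\<Sum>j\<in>J. M i j * x j) = 0) \<Longrightarrow> i \<in> I \<Longrightarrow> (\<Sum>j\<in>J. M i j * x j) = 0"
      using insert.IH[of M] by blast
    have eq: "(\<Sum>j\<in>insert a J. M i j * x j) = (\<Sum>j\<in>J. M i j * x j)" if "i \<in> I" for i x
      using that True insert(1,2) by simp
    have "(\<Sum>j\<in>insert a J. M i j * x j) = 0"
      if "\<forall>i\<in>R. (\<Sum>j\<in>insert a J. M i j * x j) = 0" "i \<in> I" for x i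
      using that R(4)[of x i] eq[of _ x] R(1) by (metis subsetD)
    moreover have "card R \<le> card (insert a J)" using R(3) insert(1,2) by simp
    ultimately show ?thesis using R(1,2) by blast
  next
    case False
    then obtain r where r: "r \<in> I" "M r a \<noteq> 0" by auto
    \<comment> \<open>Row \<open>i\<close> minus the multiple of the pivot row \<open>r\<close> that
      cancels its entry in column \<open>a\<close>.\<close>
    define M' where "M' i j = M i j - M i a / M r a * M r j" for i j
    obtain R where R: "R \<subseteq> I" "finite R" "card R \<le> card J"
      "\<And>x i. (\<forall>i\<in>R. (\<Sum>j\<in>J. M' i j * x j) = 0) \<Longrightarrow> i \<in> I \<Longrightarrow> (\<Sum>j\<in>J. M' i j * x j) = 0"
      using insert.IH[of M'] by blast
    define s where "s x i = (\<Sum>j\<in>insert a J. M i j * x j)" for x i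
    have s: "(\<Sum>j\<in>J. M' i j * x j) = s x i - M i a / M r a * s x r" for x i
    proof -
      have "(\<Sum>j\<in>J. M' i j * x j) = (\<Sum>j\<in>J. M i j * x j) - M i a / M r a * (\<Sum>j\<in>J. M r j * x j)"
        by (simp add: M'_def left_diff_distrib sum_subtractf sum_distrib_left mult.assoc)
      then show ?thesis using insert(1,2) r by (simp add: s_def distrib_left)
    qed
    have "s x i = 0" if x: "\<forall>i\<in>insert r R. s x i = 0" and i: "i \<in> I" for x i
      using R(4)[of x i] x i unfolding s by simp
    moreover have "card (insert r R) \<le> card (insert a J)"
      using R insert(1,2) by (auto simp: card_insert_if)
    ultimately show ?thesis using R r unfolding s_def
      by (intro exI[of _ "insert r R"]) blast
  qed
qed

text \<open>A known kernel vector saves one row: subtracting a multiple of \<open>\<alpha>\<close>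
  from \<open>x\<close> makes the coordinate at \<open>a\<close> vanish without changing any row
  sum, so only the unknowns in \<open>J - {a}\<close> remain.\<close>

lemma determining_rows_of_kernel:
  fixes M :: "'i \<Rightarrow> 'j \<Rightarrow> real"
  assumes J: "finite J" "a \<in> J" and \<alpha>: "\<alpha> a \<noteq> 0" "\<And>i. i \<in> I \<Longrightarrow> (\<Sum>j\<in>J. M i j * \<alpha> j) = 0"
    and I: "finite I" "card J - 1 \<le> card I"
  shows "\<exists>R\<subseteq>I. card R = card J - 1 \<and>
    (\<forall>x. (\<forall>i\<in>R. (\<Sum>j\<in>J. M i j * x j) = 0) \<longrightarrow> (\<forall>i\<in>I. (\<Sum>j\<in>J. M i j * x j) = 0))"
proof -
  obtain R where R: "R \<subseteq> I" "finite R" "card R \<le> card (J - {a})"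
    "\<And>x i. (\<forall>i\<in>R. (\<Sum>j\<in>J - {a}. M i j * x j) = 0) \<Longrightarrow> i \<in> I
      \<Longrightarrow> (\<Sum>j\<in>J - {a}. M i j * x j) = 0"
    using determining_rows[of "J - {a}" I M] J by (metis finite_Diff)
  \<comment> \<open>Fixing the exact size gives the later count the same number of remaining rows
    for every choice.\<close>
  obtain R' where R': "R \<subseteq> R'" "R' \<subseteq> I" "card R' = card J - 1"
    using exists_subset_between[of R "card J - 1" I] R I J by auto
  have "(\<Sum>j\<in>J. M i j * x j) = 0" if x: "\<forall>i\<in>R'. (\<Sum>j\<in>J. M i j * x j) = 0" and i: "i \<in> I" for x i
  proof -
    define y where "y j = x j - x a / \<alpha> a * \<alpha> j" for j
    have y: "(\<Sum>j\<in>J - {a}. M i j * y j) = (\<Sum>j\<in>J. M i j * x j)" if "i \<in> I" for i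
    proof -
      have "(\<Sum>j\<in>J - {a}. M i j * y j) = (\<Sum>j\<in>J. M i j * y j)"
        using J \<alpha> by (intro sum.mono_neutral_left) (auto simp: y_def)
      also have "\<dots> = (\<Sum>j\<in>J. M i j * x j) - x a / \<alpha> a * (\<Sum>j\<in>J. M i j * \<alpha> j)"
        by (simp add: y_def right_diff_distrib sum_subtractf sum_distrib_left mult_ac)
      finally show ?thesis using \<alpha>(2)[OF that] by simp
    qed
    have "\<forall>i\<in>R. (\<Sum>j\<in>J - {a}. M i j * y j) = 0" using x R(1) R'(1) y by (metis subsetD)
    from R(4)[OF this i] show ?thesis using y[OF i] by simp
  qed
  then show ?thesis using R' by blast
qed

text \<open>Union bound over the set \<open>R\<close> of determining rows and their contents
  \<open>X\<close>. These fix one relation with support \<open>J\<close>, and each row outside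
  \<open>R\<close> must satisfy it, which Littlewood-Offord permits for a fraction of at most
  \<open>lo_bound (card J) 1\<close> of the rows.\<close>

lemma card_support_kernel_le:
  assumes I: "finite I" and N: "finite N" and J: "J \<subseteq> N" "J \<noteq> {}" and k: "card J - 1 \<le> card I"
  shows "card {M \<in> I \<rightarrow>\<^sub>E (N \<rightarrow>\<^sub>E {0, 1 :: real}).
      \<exists>\<alpha>. (\<forall>j\<in>J. \<alpha> j \<noteq> 0) \<and> (\<forall>i\<in>I. (\<Sum>j\<in>J. M i j * \<alpha> j) = 0)}
    \<le> real (card I choose (card J - 1)) * lo_bound (card J) 1 ^ (card I - (card J - 1))
      * 2 ^ (card N * card I)"
    (is "real (card ?S) \<le> _")
proof -
  define Y where "Y = N \<rightarrow>\<^sub>E {0, 1 :: real}"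
  define k where "k = card J"
  have fJ: "finite J" using J N finite_subset by blast
  have fY: "finite Y" and cY: "card Y = 2 ^ card N"
    using N by (auto simp: Y_def finite_PiE card_PiE numeral_2_eq_2)
  define sol where "sol R X \<alpha> \<longleftrightarrow> (\<forall>j\<in>J. \<alpha> j \<noteq> 0) \<and> (\<forall>i\<in>R. (\<Sum>j\<in>J. X i j * \<alpha> j) = 0)"
    for R :: "'a set" and X :: "'a \<Rightarrow> 'b \<Rightarrow> real" and \<alpha> :: "'b \<Rightarrow> real"
  \<comment> \<open>The relation is chosen from \<open>R\<close> and \<open>X\<close> alone, so the
    set of admissible rows does not depend on the rest of the matrix.\<close>
  define Z where "Z R X = {x \<in> Y. (\<Sum>j\<in>J. x j * (SOME \<alpha>. sol R X \<alpha>) j) = 0}" for R X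
  define B where "B R X = {M \<in> I \<rightarrow>\<^sub>E Y. restrict M R = X \<and> (\<forall>i\<in>I - R. M i \<in> Z R X)}" for R X
  define \<R> where "\<R> = {R. R \<subseteq> I \<and> card R = k - 1}"
  define \<X> where "\<X> R = {X \<in> R \<rightarrow>\<^sub>E Y. \<exists>\<alpha>. sol R X \<alpha>}" for R
  have f\<R>: "finite \<R>" using I by (simp add: \<R>_def)
  have fR: "finite R" if "R \<in> \<R>" for R using that I finite_subset by (auto simp: \<R>_def)
  have f\<X>: "finite (\<X> R)" if "R \<in> \<R>" for R
    using fR[OF that] fY by (simp add: \<X>_def finite_PiE)
  have fB: "finite (B R X)" for R X using I fY by (simp add: B_def finite_PiE)
  have cover: "?S \<subseteq> (\<Union>R\<in>\<R>. \<Union>X\<in>\<X> R. B R X)"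
  proof
    fix M assume "M \<in> ?S"
    then obtain \<alpha> where M: "M \<in> I \<rightarrow>\<^sub>E Y" and \<alpha>: "sol I M \<alpha>" by (auto simp: Y_def sol_def)
    obtain a where "a \<in> J" using J by auto
    obtain R where R: "R \<subseteq> I" "card R = card J - 1"
      "\<And>x i. (\<forall>i\<in>R. (\<Sum>j\<in>J. M i j * x j) = 0) \<Longrightarrow> i \<in> I \<Longrightarrow> (\<Sum>j\<in>J. M i j * x j) = 0"
      using determining_rows_of_kernel[OF fJ \<open>a \<in> J\<close>, of \<alpha> I M] \<alpha> \<open>a \<in> J\<close> I k
      unfolding sol_def by blast
    define X where "X = restrict M R"
    have "sol R X \<alpha>" using \<alpha> R by (auto simp: sol_def X_def subset_iff)
    then have "sol R X (SOME \<alpha>. sol R X \<alpha>)" by (rule someI[of "sol R X"])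
    then have "\<forall>i\<in>R. (\<Sum>j\<in>J. M i j * (SOME \<alpha>. sol R X \<alpha>) j) = 0"
      by (simp add: sol_def X_def)
    \<comment> \<open>The chosen relation may differ from \<open>\<alpha>\<close>, but it holds on
      \<open>R\<close>, and \<open>R\<close> determines the kernel, so it holds on every row of
      \<open>M\<close>.\<close>
    from R(3)[OF this] have "M i \<in> Z R X" if "i \<in> I" for i
      using that M by (auto simp: Z_def)
    then have "M \<in> B R X" using M by (simp add: B_def X_def)
    moreover have "X \<in> \<X> R"
      using \<open>sol R X \<alpha>\<close> M R(1) by (auto simp: \<X>_def X_def)
    moreover have "R \<in> \<R>" using R by (simp add: \<R>_def k_def)
    ultimately show "M \<in> (\<Union>R\<in>\<R>. \<Union>X\<in>\<X> R. B R X)" by blast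
  qed
  have cZ: "card (Z R X) \<le> lo_bound k 1 * 2 ^ card N" if "X \<in> \<X> R" for R X
  proof -
    define \<alpha> where "\<alpha> = (SOME \<alpha>. sol R X \<alpha>)"
    have "\<exists>\<alpha>. sol R X \<alpha>" using that by (simp add: \<X>_def)
    then have "sol R X \<alpha>" unfolding \<alpha>_def by (rule someI_ex)
    define \<alpha>' where "\<alpha>' j = (if j \<in> J then \<alpha> j else 0)" for j
    have J': "{j \<in> N. \<alpha>' j \<noteq> 0} = J" using \<open>sol R X \<alpha>\<close> J by (auto simp: \<alpha>'_def sol_def)
    have "(\<Sum>j\<in>N. \<alpha>' j * x j) = (\<Sum>j\<in>J. x j * \<alpha> j)" for x
      using J N by (intro sum.mono_neutral_cong_right) (auto simp: \<alpha>'_def)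
    then have "Z R X = {x \<in> N \<rightarrow>\<^sub>E {0, 1}. (\<Sum>j\<in>N. \<alpha>' j * x j) \<in> {0}}"
      by (simp add: Z_def Y_def \<alpha>_def)
    then show ?thesis
      using littlewood_offord[OF N, of "{0}" \<alpha>'] by (simp add: J' k_def)
  qed
  have cB: "card (B R X) \<le> (lo_bound k 1 * 2 ^ card N) ^ (card I - (k - 1))"
    if R: "R \<in> \<R>" and X: "X \<in> \<X> R" for R X
  proof -
    have fIR: "finite (I - R)" and fZ: "finite (Z R X)" using I fY by (auto simp: Z_def)
    have "card (B R X) \<le> card ((I - R) \<rightarrow>\<^sub>E Z R X)"
    proof (rule card_inj_on_le)
      show "inj_on (\<lambda>M. restrict M (I - R)) (B R X)"
      proof (rule inj_onI)
        fix M M' assume M: "M \<in> B R X" "M' \<in> B R X" "restrict M (I - R) = restrict M' (I - R)"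
        then have "restrict M R = restrict M' R" "M \<in> I \<rightarrow>\<^sub>E Y" "M' \<in> I \<rightarrow>\<^sub>E Y"
          by (auto simp: B_def)
        then have "M i = M' i" if "i \<in> I" for i
          using that M(3) by (cases "i \<in> R") (metis restrict_apply', metis DiffI restrict_apply')
        then show "M = M'" using \<open>M \<in> I \<rightarrow>\<^sub>E Y\<close> \<open>M' \<in> I \<rightarrow>\<^sub>E Y\<close> by (meson PiE_ext)
      qed
      show "(\<lambda>M. restrict M (I - R)) ` B R X \<subseteq> (I - R) \<rightarrow>\<^sub>E Z R X"
        by (auto simp: B_def)
      show "finite ((I - R) \<rightarrow>\<^sub>E Z R X)" using fIR fZ by (simp add: finite_PiE)
    qed
    also have "\<dots> = card (Z R X) ^ (card I - (k - 1))"
      using fIR R fR[OF R] by (simp add: card_PiE \<R>_def card_Diff_subset)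
    finally have "real (card (B R X)) \<le> real (card (Z R X)) ^ (card I - (k - 1))"
      by (metis of_nat_le_iff of_nat_power)
    also have "\<dots> \<le> (lo_bound k 1 * 2 ^ card N) ^ (card I - (k - 1))"
      by (intro power_mono cZ X) auto
    finally show ?thesis .
  qed
  have c\<X>: "real (card (\<X> R)) \<le> (2 ^ card N) ^ (k - 1)" if R: "R \<in> \<R>" for R
  proof -
    have "card (\<X> R) \<le> card (R \<rightarrow>\<^sub>E Y)"
      using fR[OF R] fY by (intro card_mono) (auto simp: \<X>_def finite_PiE)
    also have "\<dots> = (2 ^ card N) ^ (k - 1)"
      using R fR[OF R] by (simp add: card_PiE cY \<R>_def)
    finally show ?thesis by (metis of_nat_le_iff of_nat_numeral of_nat_power)
  qed
  define c where "c = (lo_bound k 1 * 2 ^ card N) ^ (card I - (k - 1))"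
  have c0: "0 \<le> c" by (simp add: c_def lo_bound_nonneg)
  have "card ?S \<le> card (\<Union>R\<in>\<R>. \<Union>X\<in>\<X> R. B R X)"
    using f\<R> f\<X> fB cover by (intro card_mono) auto
  also have "\<dots> \<le> (\<Sum>R\<in>\<R>. card (\<Union>X\<in>\<X> R. B R X))" by (rule card_UN_le[OF f\<R>])
  also have "\<dots> \<le> (\<Sum>R\<in>\<R>. \<Sum>X\<in>\<X> R. card (B R X))" by (intro sum_mono card_UN_le f\<X>)
  finally have "real (card ?S) \<le> (\<Sum>R\<in>\<R>. \<Sum>X\<in>\<X> R. real (card (B R X)))"
    by (metis (mono_tags, lifting) of_nat_le_iff of_nat_sum sum.cong)
  also have "\<dots> \<le> (\<Sum>R\<in>\<R>. \<Sum>X\<in>\<X> R. c)" unfolding c_def by (intro sum_mono cB)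
  also have "\<dots> \<le> (\<Sum>R\<in>\<R>. (2 ^ card N) ^ (k - 1) * c)"
    using c\<X> c0 by (intro sum_mono) (simp add: mult_right_mono)
  also have "\<dots> = real (card I choose (k - 1)) * ((2 ^ card N) ^ (k - 1) * c)"
    using I by (simp add: \<R>_def n_subsets)
  also have "(2 ^ card N) ^ (k - 1) * c = lo_bound k 1 ^ (card I - (k - 1)) * 2 ^ (card N * card I)"
  proof -
    have "(2 ^ card N) ^ (k - 1) * (2 ^ card N) ^ (card I - (k - 1)) = (2 ^ card N :: real) ^ card I"
      using k by (simp add: k_def flip: power_add)
    then show ?thesis by (simp add: c_def power_mult_distrib power_mult mult.left_commute)
  qed
  finally show ?thesis by (simp add: k_def mult_ac)
qed

section \<open>Tuples of zero-one vectors\<close>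

definition tuple_rel :: "nat \<Rightarrow> nat \<Rightarrow> (nat \<Rightarrow> real vec) \<Rightarrow> (nat \<Rightarrow> real) \<Rightarrow> bool" where
  "tuple_rel d n C \<alpha> \<longleftrightarrow> (\<forall>i<d. (\<Sum>j<n. \<alpha> j * C j $ i) = 0)"

text \<open>Dependence of an indexed family: a repeated vector makes it dependent, as for the
  columns of a matrix, whereas a set does not see repetitions.\<close>

definition tuple_dep :: "nat \<Rightarrow> nat \<Rightarrow> (nat \<Rightarrow> real vec) \<Rightarrow> bool" where
  "tuple_dep d n C \<longleftrightarrow> (\<exists>\<alpha>. tuple_rel d n C \<alpha> \<and> (\<exists>j<n. \<alpha> j \<noteq> 0))"

text \<open>Only the first \<open>d\<close> coordinates are tested, so it is compared with the
  linear span only on vectors of dimension \<open>d\<close>.\<close>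

definition tuple_span :: "nat \<Rightarrow> nat \<Rightarrow> (nat \<Rightarrow> real vec) \<Rightarrow> real vec set" where
  "tuple_span d n C = {v. \<exists>\<beta>. \<forall>i<d. v $ i = (\<Sum>j<n. \<beta> j * C j $ i)}"

definition tuples :: "nat \<Rightarrow> nat \<Rightarrow> (nat \<Rightarrow> real vec) set" where
  "tuples d n = {..<n} \<rightarrow>\<^sub>E zero_one_vecs d"

lemma bij_betw_zero_one_vecs:
  "bij_betw (\<lambda>v. \<lambda>i\<in>{..<d}. v $ i) (zero_one_vecs d) ({..<d} \<rightarrow>\<^sub>E {0, 1})"
proof (rule bij_betwI[where g = "vec d"])
  show "(\<lambda>v. \<lambda>i\<in>{..<d}. v $ i) \<in> zero_one_vecs d \<rightarrow> {..<d} \<rightarrow>\<^sub>E {0, 1}"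
    unfolding zero_one_vecs_def by (intro Pi_I restrict_PiE_iff[THEN iffD2]) auto
  show "vec d \<in> ({..<d} \<rightarrow>\<^sub>E {0, 1}) \<rightarrow> zero_one_vecs d"
    by (auto simp: zero_one_vecs_def PiE_iff)
qed (auto simp: zero_one_vecs_def fun_eq_iff PiE_iff extensional_def)

lemma finite_zero_one_vecs [simp]: "finite (zero_one_vecs d)"
  and card_zero_one_vecs: "card (zero_one_vecs d) = 2 ^ d"
proof -
  have "finite ({..<d} \<rightarrow>\<^sub>E {0, 1 :: real})" by (simp add: finite_PiE)
  then show "finite (zero_one_vecs d)" using bij_betw_finite[OF bij_betw_zero_one_vecs] by blast
  show "card (zero_one_vecs d) = 2 ^ d"
    using bij_betw_same_card[OF bij_betw_zero_one_vecs, of d] by (simp add: card_PiE numeral_2_eq_2)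
qed

lemma finite_tuples [simp]: "finite (tuples d n)"
  by (simp add: tuples_def finite_PiE)

lemma card_tuples: "card (tuples d n) = 2 ^ (d * n)"
  by (simp add: tuples_def card_PiE card_zero_one_vecs power_mult)

lemma zero_vec_in_zero_one_vecs: "0\<^sub>v d \<in> zero_one_vecs d"
  by (simp add: zero_one_vecs_def)

lemma tuples_carrier: "C \<in> tuples d n \<Longrightarrow> j < n \<Longrightarrow> C j \<in> carrier_vec d"
  by (auto simp: tuples_def zero_one_vecs_def PiE_iff)

lemma card_tuples_Suc_Collect:
  "card {C \<in> tuples d (Suc n). P C} = (\<Sum>C\<in>tuples d n. card {v \<in> zero_one_vecs d. P (C(n := v))})"
  unfolding tuples_def lessThan_Suc by (rule card_PiE_insert_Collect) auto

lemma tuple_rel_Suc: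
  "tuple_rel d (Suc n) (C(n := v)) \<alpha> \<longleftrightarrow> (\<forall>i<d. (\<Sum>j<n. \<alpha> j * C j $ i) + \<alpha> n * v $ i = 0)"
  by (simp add: tuple_rel_def)

lemma tuple_dep_Suc:
  assumes "tuple_dep d n C"
  shows "tuple_dep d (Suc n) (C(n := v))"
proof -
  obtain \<alpha> j where \<alpha>: "tuple_rel d n C \<alpha>" "j < n" "\<alpha> j \<noteq> 0"
    using assms by (auto simp: tuple_dep_def)
  have "tuple_rel d (Suc n) (C(n := v)) (\<alpha>(n := 0))"
    using \<alpha>(1) by (simp add: tuple_rel_def)
  then show ?thesis using \<alpha>(2,3) by (auto simp: tuple_dep_def intro!: exI[of _ "\<alpha>(n := 0)"] exI[of _ j])
qed

lemma tuple_rel_Suc_span: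
  assumes "tuple_rel d (Suc n) (C(n := v)) \<alpha>" "\<alpha> n \<noteq> 0"
  shows "v \<in> tuple_span d n C"
  unfolding tuple_span_def
proof (intro CollectI exI[of _ "\<lambda>j. - \<alpha> j / \<alpha> n"] allI impI)
  fix i assume "i < d"
  then have "(\<Sum>j<n. \<alpha> j * C j $ i) + \<alpha> n * v $ i = 0"
    using assms(1) by (simp add: tuple_rel_Suc)
  then have "v $ i = - (\<Sum>j<n. \<alpha> j * C j $ i) / \<alpha> n"
    using assms(2) by (simp add: field_simps)
  also have "\<dots> = (\<Sum>j<n. - \<alpha> j / \<alpha> n * C j $ i)"
    by (simp add: sum_negf sum_divide_distrib)
  finally show "v $ i = (\<Sum>j<n. - \<alpha> j / \<alpha> n * C j $ i)" .
qed

lemma tuple_dep_Suc_iff: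
  assumes "\<not> tuple_dep d n C"
  shows "tuple_dep d (Suc n) (C(n := v)) \<longleftrightarrow> v \<in> tuple_span d n C"
proof
  assume "tuple_dep d (Suc n) (C(n := v))"
  then obtain \<alpha> j where \<alpha>: "tuple_rel d (Suc n) (C(n := v)) \<alpha>" "j < Suc n" "\<alpha> j \<noteq> 0"
    by (auto simp: tuple_dep_def)
  have "\<alpha> n \<noteq> 0"
  proof
    assume 0: "\<alpha> n = 0"
    then have "tuple_rel d n C \<alpha>" using \<alpha>(1) by (simp add: tuple_rel_def)
    moreover have "j < n" using \<alpha> 0 by (cases "j = n") auto
    ultimately show False using assms \<alpha> by (auto simp: tuple_dep_def)
  qed
  then show "v \<in> tuple_span d n C" using tuple_rel_Suc_span \<alpha>(1) by blast
next
  assume "v \<in> tuple_span d n C"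
  then obtain \<beta> where "\<forall>i<d. v $ i = (\<Sum>j<n. \<beta> j * C j $ i)" by (auto simp: tuple_span_def)
  then have "tuple_rel d (Suc n) (C(n := v)) (\<beta>(n := -1))"
    by (simp add: tuple_rel_def)
  then show "tuple_dep d (Suc n) (C(n := v))"
    by (auto simp: tuple_dep_def intro!: exI[of _ "\<beta>(n := -1)"] exI[of _ n])
qed

section \<open>Singular matrices as dependent tuples of columns\<close>

lemma singular_mat_iff_kernel:
  assumes A: "A \<in> carrier_mat d d"
  shows "singular_mat A \<longleftrightarrow> (\<exists>v. v \<in> carrier_vec d \<and> v \<noteq> 0\<^sub>v d \<and> A *\<^sub>v v = 0\<^sub>v d)"
proof -
  have "invertible_mat A" if nz: "det A \<noteq> 0"
  proof -
    obtain B where "B \<in> carrier_mat d d" "A * B = 1\<^sub>m d" "B * A = 1\<^sub>m d"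
      using det_non_zero_imp_unit[OF A nz, of "()"] by (auto simp: Units_def ring_mat_def)
    then show ?thesis using A by (auto simp: invertible_mat_def inverts_mat_def)
  qed
  moreover have "v = 0\<^sub>v d" if inv: "invertible_mat A" and v: "v \<in> carrier_vec d" "A *\<^sub>v v = 0\<^sub>v d" for v
  proof -
    obtain B where AB: "A * B = 1\<^sub>m d" and BA: "B * A = 1\<^sub>m (dim_row B)"
      using inv A by (auto simp: invertible_mat_def inverts_mat_def)
    \<comment> \<open>\<open>invertible_mat\<close> leaves the shape of the inverse open; the two
      products force it to be square of size \<open>d\<close>.\<close>
    have "dim_row B = d" using arg_cong[OF BA, of dim_col] A by simp
    moreover have "dim_col B = d" using arg_cong[OF AB, of dim_col] by simp
    ultimately have B: "B \<in> carrier_mat d d" by auto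
    have "v = 1\<^sub>m d *\<^sub>v v" using v by simp
    also have "\<dots> = (B * A) *\<^sub>v v" using BA B by simp
    also have "\<dots> = B *\<^sub>v (A *\<^sub>v v)" by (rule assoc_mult_mat_vec[OF B A v(1)])
    also have "\<dots> = 0\<^sub>v d" using v(2) B by auto
    finally show ?thesis .
  qed
  ultimately show ?thesis unfolding singular_mat_def det_0_iff_vec_prod_zero[OF A, symmetric]
    using det_0_iff_vec_prod_zero[OF A] by blast
qed

definition tuple_mat :: "nat \<Rightarrow> (nat \<Rightarrow> real vec) \<Rightarrow> real mat" where
  "tuple_mat d C = mat d d (\<lambda>(i, j). C j $ i)"

lemma tuple_mat_carrier [simp]: "tuple_mat d C \<in> carrier_mat d d"
  by (simp add: tuple_mat_def)

lemma singular_tuple_mat: "singular_mat (tuple_mat d C) \<longleftrightarrow> tuple_dep d d C"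
proof -
  have mult: "tuple_mat d C *\<^sub>v vec d \<alpha> = 0\<^sub>v d \<longleftrightarrow> tuple_rel d d C \<alpha>" for \<alpha>
    by (auto simp: tuple_mat_def tuple_rel_def vec_eq_iff scalar_prod_def mult.commute lessThan_atLeast0)
  have nz: "vec d \<alpha> \<noteq> 0\<^sub>v d \<longleftrightarrow> (\<exists>j<d. \<alpha> j \<noteq> 0)" for \<alpha> :: "nat \<Rightarrow> real"
    by (auto simp: vec_eq_iff)
  show ?thesis
  proof
    assume "singular_mat (tuple_mat d C)"
    then obtain v where v: "v \<in> carrier_vec d" "v \<noteq> 0\<^sub>v d" "tuple_mat d C *\<^sub>v v = 0\<^sub>v d"
      using singular_mat_iff_kernel[OF tuple_mat_carrier] by blast
    moreover have "vec d (\<lambda>j. v $ j) = v" using v(1) by auto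
    ultimately show "tuple_dep d d C"
      using mult[of "\<lambda>j. v $ j"] nz[of "\<lambda>j. v $ j"] by (auto simp: tuple_dep_def)
  next
    assume "tuple_dep d d C"
    then show "singular_mat (tuple_mat d C)"
      unfolding tuple_dep_def singular_mat_iff_kernel[OF tuple_mat_carrier] mult[symmetric] nz[symmetric]
      by (metis vec_carrier)
  qed
qed

lemma bij_betw_tuple_mat: "bij_betw (tuple_mat d) (tuples d d) (zero_one_mats d)"
proof (rule bij_betwI[where g = "\<lambda>A. \<lambda>j\<in>{..<d}. vec d (\<lambda>i. A $$ (i, j))"])
  show "tuple_mat d \<in> tuples d d \<rightarrow> zero_one_mats d"
    by (auto simp: tuples_def tuple_mat_def zero_one_mats_def zero_one_vecs_def PiE_iff)
  show "(\<lambda>A. \<lambda>j\<in>{..<d}. vec d (\<lambda>i. A $$ (i, j))) \<in> zero_one_mats d \<rightarrow> tuples d d"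
    unfolding tuples_def
    by (intro Pi_I restrict_PiE_iff[THEN iffD2]) (auto simp: zero_one_mats_def zero_one_vecs_def)
next
  fix C assume C: "C \<in> tuples d d"
  show "(\<lambda>j\<in>{..<d}. vec d (\<lambda>i. tuple_mat d C $$ (i, j))) = C"
  proof
    fix j
    show "(\<lambda>j\<in>{..<d}. vec d (\<lambda>i. tuple_mat d C $$ (i, j))) j = C j"
    proof (cases "j < d")
      case True
      then show ?thesis using tuples_carrier[OF C True] by (auto simp: tuple_mat_def)
    next
      case False
      then show ?thesis using C by (auto simp: tuples_def PiE_iff extensional_def)
    qed
  qed
qed (auto simp: tuple_mat_def zero_one_mats_def)

lemma P_s_eq: "P_s d = card {C \<in> tuples d d. tuple_dep d d C} / 2 ^ (d * d)"
proof -
  note bij = bij_betw_tuple_mat[of d]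
  have fin: "finite (zero_one_mats d)" using bij_betw_finite[OF bij] by simp
  have card: "card (zero_one_mats d) = 2 ^ (d * d)"
    using bij_betw_same_card[OF bij] by (simp add: card_tuples)
  then have ne: "zero_one_mats d \<noteq> {}" by auto
  have im: "tuple_mat d ` tuples d d = zero_one_mats d" using bij by (simp add: bij_betw_def)
  have "bij_betw (tuple_mat d) {C \<in> tuples d d. tuple_dep d d C} {A \<in> zero_one_mats d. singular_mat A}"
    using bij by (rule bij_betw_subset) (auto simp: singular_tuple_mat simp flip: im)
  then have "card {A \<in> zero_one_mats d. singular_mat A} = card {C \<in> tuples d d. tuple_dep d d C}"
    by (simp add: bij_betw_same_card)
  then show ?thesis
    unfolding P_s_def measure_pmf_of_set[OF ne fin] card by (simp add: Int_def)
qed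

text \<open>Fewer than \<open>d\<close> vectors lie in a hyperplane with some normal vector
  \<open>y\<close>, and Littlewood-Offord for the coefficients of \<open>y\<close> bounds the
  fraction of zero-one vectors in it.\<close>

lemma card_zero_one_vecs_tuple_span_le:
  assumes "n < d"
  shows "2 * card (zero_one_vecs d \<inter> tuple_span d n C) \<le> 2 ^ d"
proof -
  \<comment> \<open>Padding with zero columns gives a singular square matrix; a kernel vector of its
    transpose is the normal vector.\<close>
  define C' where "C' j = (if j < n then C j else 0\<^sub>v d)" for j
  have "tuple_rel d d C' (\<lambda>j. if j = n then 1 else 0)"
    unfolding tuple_rel_def
  proof (intro allI impI)
    fix i assume i: "i < d"
    show "(\<Sum>j<d. (if j = n then 1 else 0) * C' j $ i) = 0"
      by (rule sum.neutral) (use i in \<open>auto simp: C'_def\<close>)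
  qed
  then have "tuple_dep d d C'" using assms by (auto simp: tuple_dep_def intro!: exI[of _ "\<lambda>j. if j = n then 1 else 0"])
  then have "singular_mat (tuple_mat d C')" by (simp add: singular_tuple_mat)
  then have "det (tuple_mat d C') = 0"
    using singular_mat_iff_kernel[OF tuple_mat_carrier] det_0_iff_vec_prod_zero[OF tuple_mat_carrier] by blast
  then have "det (transpose_mat (tuple_mat d C')) = 0"
    by (simp add: det_transpose[OF tuple_mat_carrier])
  then obtain y where y: "y \<in> carrier_vec d" "y \<noteq> 0\<^sub>v d" "transpose_mat (tuple_mat d C') *\<^sub>v y = 0\<^sub>v d"
    using det_0_iff_vec_prod_zero[of "transpose_mat (tuple_mat d C')" d] by auto
  have orth: "(\<Sum>i<d. C j $ i * y $ i) = 0" if "j < n" for j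
  proof -
    have "(transpose_mat (tuple_mat d C') *\<^sub>v y) $ j = 0" using y(3) that assms by simp
    then show ?thesis using that assms y(1)
      by (simp add: tuple_mat_def scalar_prod_def C'_def lessThan_atLeast0)
  qed
  have span: "(\<Sum>i<d. y $ i * v $ i) = 0" if "v \<in> tuple_span d n C" for v
  proof -
    obtain \<beta> where \<beta>: "\<forall>i<d. v $ i = (\<Sum>j<n. \<beta> j * C j $ i)" using \<open>v \<in> tuple_span d n C\<close> by (auto simp: tuple_span_def)
    have "(\<Sum>i<d. y $ i * v $ i) = (\<Sum>i<d. \<Sum>j<n. \<beta> j * (C j $ i * y $ i))"
      using \<beta> by (intro sum.cong) (auto simp: sum_distrib_left mult_ac)
    also have "\<dots> = (\<Sum>j<n. \<beta> j * (\<Sum>i<d. C j $ i * y $ i))"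
      by (subst sum.swap) (simp add: sum_distrib_left)
    also have "\<dots> = 0" by (simp add: orth)
    finally show ?thesis .
  qed
  define T where "T = {x \<in> {..<d} \<rightarrow>\<^sub>E {0, 1}. (\<Sum>i\<in>{..<d}. y $ i * x i) \<in> {0}}"
  have "finite T" by (simp add: T_def finite_PiE)
  have "card (zero_one_vecs d \<inter> tuple_span d n C) \<le> card T"
  proof (rule card_inj_on_le[OF _ _ \<open>finite T\<close>])
    show "inj_on (\<lambda>v. \<lambda>i\<in>{..<d}. v $ i) (zero_one_vecs d \<inter> tuple_span d n C)"
      using bij_betw_zero_one_vecs[of d] by (auto simp: bij_betw_def intro: inj_on_subset)
    show "(\<lambda>v. \<lambda>i\<in>{..<d}. v $ i) ` (zero_one_vecs d \<inter> tuple_span d n C) \<subseteq> T"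
      using bij_betw_zero_one_vecs[of d] span by (auto simp: bij_betw_def T_def)
  qed
  also have "real (card T) \<le> lo_bound (card {i \<in> {..<d}. y $ i \<noteq> 0}) (card {0 :: real}) * 2 ^ card {..<d}"
    unfolding T_def by (rule littlewood_offord) auto
  \<comment> \<open>A single nonzero coefficient of \<open>y\<close> is enough for the factor
    \<open>1 / 2\<close>.\<close>
  also have "\<dots> \<le> lo_bound 1 1 * 2 ^ d"
  proof -
    have "{i \<in> {..<d}. y $ i \<noteq> 0} \<noteq> {}" using y(1,2) by (auto simp: vec_eq_iff)
    then have "1 \<le> card {i \<in> {..<d}. y $ i \<noteq> 0}" by (simp add: Suc_le_eq card_gt_0_iff)
    then show ?thesis by (auto intro!: mult_right_mono lo_bound_antimono simp del: lo_bound.simps)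
  qed
  finally have "2 * real (card (zero_one_vecs d \<inter> tuple_span d n C)) \<le> 2 ^ d"
    unfolding lo_bound_1_1 by simp
  then show ?thesis by (metis of_nat_le_iff of_nat_mult of_nat_numeral of_nat_power)
qed

text \<open>Transposition: the independent choices in \<open>card_support_kernel_le\<close> are
  rows, while the entries of a tuple are columns.\<close>

lemma card_tuples_support_le:
  assumes J: "J \<subseteq> {..<n}" "J \<noteq> {}" and k: "card J - 1 \<le> d"
  shows "real (card {C \<in> tuples d n. \<exists>\<alpha>. (\<forall>j\<in>J. \<alpha> j \<noteq> 0) \<and> (\<forall>i<d. (\<Sum>j\<in>J. C j $ i * \<alpha> j) = 0)})
    \<le> real (d choose (card J - 1)) * lo_bound (card J) 1 ^ (d - (card J - 1)) * 2 ^ (d * n)"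
    (is "real (card ?S) \<le> _")
proof -
  define T where "T = {M \<in> {..<d} \<rightarrow>\<^sub>E ({..<n} \<rightarrow>\<^sub>E {0, 1 :: real}).
      \<exists>\<alpha>. (\<forall>j\<in>J. \<alpha> j \<noteq> 0) \<and> (\<forall>i\<in>{..<d}. (\<Sum>j\<in>J. M i j * \<alpha> j) = 0)}"
  define f where "f C = (\<lambda>i\<in>{..<d}. \<lambda>j\<in>{..<n}. C j $ i)" for C :: "nat \<Rightarrow> real vec"
  have fT: "finite T" by (simp add: T_def finite_PiE)
  have "card ?S \<le> card T"
  proof (rule card_inj_on_le[OF _ _ fT])
    show "inj_on f ?S"
    proof (rule inj_onI)
      fix C C' assume "C \<in> ?S" "C' \<in> ?S" and eq: "f C = f C'"
      then have C: "C \<in> tuples d n" "C' \<in> tuples d n" by auto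
      have "C j $ i = C' j $ i" if "i < d" "j < n" for i j
        using fun_cong[OF fun_cong[OF eq, of i], of j] that by (simp add: f_def)
      then have "C j = C' j" if "j < n" for j
        using tuples_carrier[OF C(1) that] tuples_carrier[OF C(2) that] that by (intro eq_vecI) auto
      then show "C = C'" using C unfolding tuples_def by (intro PiE_ext[of C _ _ C']) auto
    qed
    show "f ` ?S \<subseteq> T"
    proof
      fix M assume "M \<in> f ` ?S"
      then obtain C \<alpha> where C: "C \<in> tuples d n" "M = f C" and \<alpha>: "\<forall>j\<in>J. \<alpha> j \<noteq> 0"
        "\<forall>i<d. (\<Sum>j\<in>J. C j $ i * \<alpha> j) = 0" by auto
      have "(\<Sum>j\<in>J. M i j * \<alpha> j) = 0" if "i < d" for i
      proof -
        have "(\<Sum>j\<in>J. M i j * \<alpha> j) = (\<Sum>j\<in>J. C j $ i * \<alpha> j)"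
          using J that by (intro sum.cong) (auto simp: C f_def)
        then show ?thesis using \<alpha> that by simp
      qed
      moreover have "M \<in> {..<d} \<rightarrow>\<^sub>E ({..<n} \<rightarrow>\<^sub>E {0, 1})"
        using C(1) unfolding C(2) f_def
        by (intro restrict_PiE_iff[THEN iffD2] ballI) (auto simp: tuples_def PiE_iff zero_one_vecs_def)
      ultimately show "M \<in> T" using \<alpha>(1) by (auto simp: T_def)
    qed
  qed
  then have "real (card ?S) \<le> real (card T)" by simp
  also have "\<dots> \<le> real (card {..<d} choose (card J - 1)) * lo_bound (card J) 1 ^ (card {..<d} - (card J - 1))
      * 2 ^ (card {..<n} * card {..<d})"
    unfolding T_def using J k by (intro card_support_kernel_le) auto
  finally show ?thesis by (simp add: mult.commute)
qed

section \<open>From tuples to linearly independent sets\<close>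

lemma tuple_dep_if_not_inj:
  assumes "\<not> inj_on C {..<n}"
  shows "tuple_dep d n C"
proof -
  obtain j l where jl: "j < n" "l < n" "j \<noteq> l" "C j = C l" using assms by (auto simp: inj_on_def)
  define \<alpha> :: "nat \<Rightarrow> real" where "\<alpha> m = (if m = j then 1 else if m = l then -1 else 0)" for m
  have "(\<Sum>m<n. \<alpha> m * C m $ i) = 0" for i
  proof -
    have "(\<Sum>m<n. \<alpha> m * C m $ i) = (\<Sum>m\<in>{j, l}. \<alpha> m * C m $ i)"
      using jl by (intro sum.mono_neutral_right) (auto simp: \<alpha>_def)
    also have "\<dots> = 0" using jl by (simp add: \<alpha>_def)
    finally show ?thesis .
  qed
  then have "tuple_rel d n C \<alpha>" by (simp add: tuple_rel_def)
  moreover have "\<alpha> j \<noteq> 0" by (simp add: \<alpha>_def)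
  ultimately show ?thesis using jl(1) by (auto simp: tuple_dep_def)
qed

lemma tuple_dep_if_zero:
  assumes "j < n" "C j = 0\<^sub>v d"
  shows "tuple_dep d n C"
proof -
  define \<alpha> :: "nat \<Rightarrow> real" where "\<alpha> m = (if m = j then 1 else 0)" for m
  have "(\<Sum>m<n. \<alpha> m * C m $ i) = 0" if "i < d" for i
    by (rule sum.neutral) (use assms that in \<open>auto simp: \<alpha>_def\<close>)
  then have "tuple_rel d n C \<alpha>" by (simp add: tuple_rel_def)
  then show ?thesis using assms(1) by (auto simp: tuple_dep_def \<alpha>_def intro!: exI[of _ \<alpha>])
qed

text \<open>For an injective tuple, coefficients indexed by positions and coefficients indexed by
  vectors correspond via \<open>inv_into\<close>.\<close>

lemma lin_indpt_image_iff:
  assumes C: "C \<in> tuples d n" and inj: "inj_on C {..<n}"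
  shows "real_lin_indpt d (C ` {..<n}) \<longleftrightarrow> \<not> tuple_dep d n C"
proof -
  interpret vec_space "TYPE(real)" d .
  have G: "C ` {..<n} \<subseteq> carrier_vec d" using tuples_carrier[OF C] by auto
  have lc: "lincomb a (C ` {..<n}) $ i = (\<Sum>j<n. a (C j) * C j $ i)" if "i < d" for a i
    using that lincomb_index[OF that G] sum.reindex[OF inj] by simp
  have "lin_dep (C ` {..<n}) \<longleftrightarrow> tuple_dep d n C"
  proof
    assume "lin_dep (C ` {..<n})"
    then obtain a v where a: "lincomb a (C ` {..<n}) = 0\<^sub>v d" "v \<in> C ` {..<n}" "a v \<noteq> 0"
      using finite_lin_dep[of "C ` {..<n}"] G by auto
    have "tuple_rel d n C (\<lambda>j. a (C j))"
      using a(1) by (simp add: tuple_rel_def flip: lc)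
    then show "tuple_dep d n C" using a(2,3) by (auto simp: tuple_dep_def)
  next
    assume "tuple_dep d n C"
    then obtain \<alpha> j where \<alpha>: "tuple_rel d n C \<alpha>" "j < n" "\<alpha> j \<noteq> 0" by (auto simp: tuple_dep_def)
    define a where "a v = \<alpha> (inv_into {..<n} C v)" for v
    have aC: "a (C j) = \<alpha> j" if "j < n" for j using inj that by (simp add: a_def)
    have "lincomb a (C ` {..<n}) = 0\<^sub>v d"
    proof (rule eq_vecI)
      show "dim_vec (lincomb a (C ` {..<n})) = dim_vec (0\<^sub>v d)"
        using lincomb_dim[OF _ G] by simp
      fix i assume "i < dim_vec (0\<^sub>v d)"
      then show "lincomb a (C ` {..<n}) $ i = 0\<^sub>v d $ i"
        using \<alpha>(1) by (simp add: lc aC tuple_rel_def)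
    qed
    then show "lin_dep (C ` {..<n})"
      using \<alpha>(2,3) aC by (intro lin_dep_crit[where A = "C ` {..<n}" and a = a and v = "C j"]) auto
  qed
  then show ?thesis by simp
qed

lemma span_image_iff:
  assumes C: "C \<in> tuples d n" and inj: "inj_on C {..<n}" and v: "v \<in> carrier_vec d"
  shows "v \<in> real_span d (C ` {..<n}) \<longleftrightarrow> v \<in> tuple_span d n C"
proof -
  interpret vec_space "TYPE(real)" d .
  have G: "C ` {..<n} \<subseteq> carrier_vec d" using tuples_carrier[OF C] by auto
  have lc: "lincomb a (C ` {..<n}) $ i = (\<Sum>j<n. a (C j) * C j $ i)" if "i < d" for a i
    using that lincomb_index[OF that G] sum.reindex[OF inj] by simp
  have sp: "span (C ` {..<n}) = {lincomb a (C ` {..<n}) | a. a \<in> C ` {..<n} \<rightarrow> UNIV}"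
    using finite_span[of "C ` {..<n}"] G by simp
  have "v \<in> span (C ` {..<n}) \<longleftrightarrow> v \<in> tuple_span d n C"
  proof
    assume "v \<in> span (C ` {..<n})"
    then obtain a where "v = lincomb a (C ` {..<n})" unfolding sp by auto
    then show "v \<in> tuple_span d n C" using lc[of _ a]
      by (auto simp: tuple_span_def intro!: exI[of _ "\<lambda>j. a (C j)"])
  next
    assume "v \<in> tuple_span d n C"
    then obtain \<beta> where \<beta>: "\<forall>i<d. v $ i = (\<Sum>j<n. \<beta> j * C j $ i)" by (auto simp: tuple_span_def)
    define a where "a v = \<beta> (inv_into {..<n} C v)" for v
    have aC: "a (C j) = \<beta> j" if "j < n" for j using inj that by (simp add: a_def)
    have "v = lincomb a (C ` {..<n})"
    proof (rule eq_vecI)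
      show "dim_vec v = dim_vec (lincomb a (C ` {..<n}))"
        using lincomb_dim[OF _ G] v by simp
      fix i assume "i < dim_vec (lincomb a (C ` {..<n}))"
      then have "i < d" using lincomb_dim[OF _ G] by simp
      then show "v $ i = lincomb a (C ` {..<n}) $ i"
        using \<beta> by (simp add: lc aC)
    qed
    then show "v \<in> span (C ` {..<n})" unfolding sp by auto
  qed
  then show ?thesis by simp
qed

text \<open>Independent tuples are injective, so each independent set of \<open>d - 1\<close>
  vectors arises from exactly \<open>fact (d - 1)\<close> of them, its orderings.\<close>

lemma sum_independent_tuples:
  fixes f :: "real vec set \<Rightarrow> real"
  shows "(\<Sum>C | C \<in> tuples d (d - 1) \<and> \<not> tuple_dep d (d - 1) C. f (C ` {..<d - 1}))
    = fact (d - 1) * (\<Sum>G\<in>lin_indpt_sets d. f G)"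
proof -
  define n where "n = d - 1"
  define Ind where "Ind = {C. C \<in> tuples d n \<and> \<not> tuple_dep d n C}"
  have fin: "finite Ind" by (simp add: Ind_def)
  have fG: "finite (lin_indpt_sets d)"
    by (rule finite_subset[of _ "Pow (zero_one_vecs d)"]) (auto simp: lin_indpt_sets_def)
  have inj: "inj_on C {..<n}" if "C \<in> Ind" for C
    using that tuple_dep_if_not_inj by (auto simp: Ind_def)
  have im: "(\<lambda>C. C ` {..<n}) ` Ind \<subseteq> lin_indpt_sets d"
  proof
    fix G assume "G \<in> (\<lambda>C. C ` {..<n}) ` Ind"
    then obtain C where C: "C \<in> Ind" "G = C ` {..<n}" by auto
    then have "G \<subseteq> zero_one_vecs d" by (auto simp: Ind_def tuples_def PiE_iff)
    moreover have "card G = n" using inj[OF C(1)] C(2) by (simp add: card_image)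
    moreover have "real_lin_indpt d G"
      using C lin_indpt_image_iff[of C d n] inj[OF C(1)] by (simp add: Ind_def)
    ultimately show "G \<in> lin_indpt_sets d" by (simp add: lin_indpt_sets_def n_def)
  qed
  have fiber: "card {C \<in> Ind. C ` {..<n} = G} = fact n" if G: "G \<in> lin_indpt_sets d" for G
  proof -
    have G': "G \<subseteq> zero_one_vecs d" "card G = n" "real_lin_indpt d G"
      using G by (auto simp: lin_indpt_sets_def n_def)
    have fG: "finite G" using G'(1) finite_zero_one_vecs finite_subset by blast
    have "{C \<in> Ind. C ` {..<n} = G} = {C \<in> {..<n} \<rightarrow>\<^sub>E G. inj_on C {..<n}}"
    proof (intro equalityI subsetI)
      fix C assume C: "C \<in> {C \<in> Ind. C ` {..<n} = G}"
      then show "C \<in> {C \<in> {..<n} \<rightarrow>\<^sub>E G. inj_on C {..<n}}"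
        using inj[of C] by (auto simp: Ind_def tuples_def PiE_iff)
    next
      fix C assume C: "C \<in> {C \<in> {..<n} \<rightarrow>\<^sub>E G. inj_on C {..<n}}"
      then have t: "C \<in> tuples d n" using G'(1) by (auto simp: tuples_def PiE_iff)
      have "C ` {..<n} = G"
        using C fG G'(2) by (intro card_subset_eq) (auto simp: card_image)
      then show "C \<in> {C \<in> Ind. C ` {..<n} = G}"
        using t C lin_indpt_image_iff[OF t] G'(3) by (simp add: Ind_def)
    qed
    also have "card \<dots> = fact n"
      using card_inj_on_subset_funcset[of "{..<n}" G "{..<n}"] fG G'(2) fact_prod_rev[of n, where 'a = nat]
      by simp
    finally show ?thesis .
  qed
  have "(\<Sum>C\<in>Ind. f (C ` {..<n})) = (\<Sum>G\<in>lin_indpt_sets d. \<Sum>C | C \<in> Ind \<and> C ` {..<n} = G. f (C ` {..<n}))"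
    by (rule sum.group[OF fin fG im, symmetric])
  also have "\<dots> = (\<Sum>G\<in>lin_indpt_sets d. fact n * f G)"
  proof (rule sum.cong[OF refl])
    fix G assume G: "G \<in> lin_indpt_sets d"
    have "(\<Sum>C | C \<in> Ind \<and> C ` {..<n} = G. f (C ` {..<n})) = (\<Sum>C | C \<in> Ind \<and> C ` {..<n} = G. f G)"
      by (intro sum.cong) auto
    then show "(\<Sum>C | C \<in> Ind \<and> C ` {..<n} = G. f (C ` {..<n})) = fact n * f G"
      using fiber[OF G] by simp
  qed
  finally show ?thesis by (simp add: Ind_def n_def sum_distrib_left)
qed

text \<open>As all independent sets have equally many orderings, averaging over independent tuples
  gives the same mean as averaging over sets.\<close>

lemma sum_card_tuple_span:
  "(\<Sum>C | C \<in> tuples d (d - 1) \<and> \<not> tuple_dep d (d - 1) C.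
      real (card (zero_one_vecs d \<inter> tuple_span d (d - 1) C)))
    = real (card {C \<in> tuples d (d - 1). \<not> tuple_dep d (d - 1) C}) * expected_spanned d"
proof -
  define S where "S = (\<Sum>G\<in>lin_indpt_sets d. real (num_spanned d G))"
  have fG: "finite (lin_indpt_sets d)"
    by (rule finite_subset[of _ "Pow (zero_one_vecs d)"]) (auto simp: lin_indpt_sets_def)
  have "(\<Sum>C | C \<in> tuples d (d - 1) \<and> \<not> tuple_dep d (d - 1) C.
      real (card (zero_one_vecs d \<inter> tuple_span d (d - 1) C)))
    = (\<Sum>C | C \<in> tuples d (d - 1) \<and> \<not> tuple_dep d (d - 1) C. real (num_spanned d (C ` {..<d - 1})))"
  proof (intro sum.cong refl)
    fix C assume C: "C \<in> {C \<in> tuples d (d - 1). \<not> tuple_dep d (d - 1) C}"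
    then have "inj_on C {..<d - 1}" using tuple_dep_if_not_inj by auto
    then have "zero_one_vecs d \<inter> tuple_span d (d - 1) C = zero_one_vecs d \<inter> real_span d (C ` {..<d - 1})"
      using span_image_iff[of C d "d - 1"] C by (auto simp: zero_one_vecs_def)
    then show "real (card (zero_one_vecs d \<inter> tuple_span d (d - 1) C)) = real (num_spanned d (C ` {..<d - 1}))"
      by (simp add: num_spanned_def)
  qed
  also have "\<dots> = fact (d - 1) * S" unfolding S_def by (rule sum_independent_tuples)
  \<comment> \<open>The case split guards the division: if there is no independent set, then
    \<open>S = 0\<close> and both sides vanish.\<close>
  also have "\<dots> = (fact (d - 1) * real (card (lin_indpt_sets d))) * (S / real (card (lin_indpt_sets d)))"
    using fG by (cases "lin_indpt_sets d = {}") (auto simp: S_def)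
  also have "fact (d - 1) * real (card (lin_indpt_sets d)) = real (card {C \<in> tuples d (d - 1). \<not> tuple_dep d (d - 1) C})"
    using sum_independent_tuples[of "\<lambda>_. 1" d] by simp
  finally show ?thesis by (simp add: expected_spanned_def S_def)
qed

section \<open>Conditioning on the first \<open>d - 1\<close> columns\<close>

definition dep_prob :: "nat \<Rightarrow> real" where
  "dep_prob d = card {C \<in> tuples d (d - 1). tuple_dep d (d - 1) C} / 2 ^ (d * (d - 1))"

text \<open>A dependent tuple stays dependent for each of the \<open>2 ^ d\<close> last columns; an
  independent one becomes dependent exactly for the last columns in its span.\<close>

lemma P_s_decomposition:
  assumes "d \<ge> 1"
  shows "P_s d = dep_prob d + (1 - dep_prob d) * (expected_spanned d / 2 ^ d)"
proof -
  define n where "n = d - 1"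
  have d: "d = Suc n" using assms by (simp add: n_def)
  define A where "A = {C \<in> tuples d n. tuple_dep d n C}"
  define B where "B = {C \<in> tuples d n. \<not> tuple_dep d n C}"
  have AB: "tuples d n = A \<union> B" "A \<inter> B = {}" "finite A" "finite B" by (auto simp: A_def B_def)
  then have cAB: "real (card A) + real (card B) = 2 ^ (d * n)"
    using card_Un_disjoint[of A B] card_tuples[of d n]
    by (metis of_nat_add of_nat_numeral of_nat_power)
  have "card {C \<in> tuples d d. tuple_dep d d C} = (\<Sum>C\<in>tuples d n. card {v \<in> zero_one_vecs d. tuple_dep d d (C(n := v))})"
    unfolding d by (rule card_tuples_Suc_Collect)
  also have "\<dots> = (\<Sum>C\<in>A. card {v \<in> zero_one_vecs d. tuple_dep d d (C(n := v))})
      + (\<Sum>C\<in>B. card {v \<in> zero_one_vecs d. tuple_dep d d (C(n := v))})"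
    unfolding AB(1) by (rule sum.union_disjoint) (use AB in auto)
  also have "(\<Sum>C\<in>A. card {v \<in> zero_one_vecs d. tuple_dep d d (C(n := v))}) = (\<Sum>C\<in>A. 2 ^ d)"
  proof (intro sum.cong refl)
    fix C assume "C \<in> A"
    then have "{v \<in> zero_one_vecs d. tuple_dep d d (C(n := v))} = zero_one_vecs d"
      using tuple_dep_Suc[of d n C] by (auto simp: A_def d)
    then show "card {v \<in> zero_one_vecs d. tuple_dep d d (C(n := v))} = 2 ^ d"
      by (simp add: card_zero_one_vecs)
  qed
  also have "(\<Sum>C\<in>B. card {v \<in> zero_one_vecs d. tuple_dep d d (C(n := v))})
      = (\<Sum>C\<in>B. card (zero_one_vecs d \<inter> tuple_span d n C))"
  proof (intro sum.cong refl arg_cong[where f = card])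
    fix C assume "C \<in> B"
    then show "{v \<in> zero_one_vecs d. tuple_dep d d (C(n := v))} = zero_one_vecs d \<inter> tuple_span d n C"
      using tuple_dep_Suc_iff[of d n C] by (auto simp: B_def d)
  qed
  finally have "real (card {C \<in> tuples d d. tuple_dep d d C})
      = card A * 2 ^ d + (\<Sum>C\<in>B. real (card (zero_one_vecs d \<inter> tuple_span d n C)))"
    by simp
  also have "(\<Sum>C\<in>B. real (card (zero_one_vecs d \<inter> tuple_span d n C))) = real (card B) * expected_spanned d"
    using sum_card_tuple_span[of d] by (simp add: B_def n_def)
  finally have "P_s d = (card A * 2 ^ d + real (card B) * expected_spanned d) / 2 ^ (d * d)"
    by (simp add: P_s_eq)
  also have "(2 :: real) ^ (d * d) = 2 ^ (d * n) * 2 ^ d"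
    by (simp add: d flip: power_add)
  also have "(card A * 2 ^ d + real (card B) * expected_spanned d) / (2 ^ (d * n) * 2 ^ d)
      = card A / 2 ^ (d * n) + card B / 2 ^ (d * n) * (expected_spanned d / 2 ^ d)"
    by (simp add: field_simps)
  also have "card A / 2 ^ (d * n) = dep_prob d" by (simp add: A_def dep_prob_def n_def)
  also have "card B / 2 ^ (d * n) = 1 - dep_prob d"
    unfolding \<open>card A / 2 ^ (d * n) = dep_prob d\<close>[symmetric] using cAB by (simp add: field_simps)
  finally show ?thesis .
qed

section \<open>Linear relations with large support\<close>

definition small_rel :: "nat \<Rightarrow> nat \<Rightarrow> nat \<Rightarrow> (nat \<Rightarrow> real vec) \<Rightarrow> bool" where
  "small_rel d n K C \<longleftrightarrow>
    (\<exists>\<alpha>. tuple_rel d n C \<alpha> \<and> (\<exists>j<n. \<alpha> j \<noteq> 0) \<and> card {j. j < n \<and> \<alpha> j \<noteq> 0} \<le> K)"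

text \<open>The last condition says that \<open>i\<close> is a coloop of the column matroid: column
  \<open>i\<close> is not in the span of the other columns.\<close>

definition coloop_tuples :: "nat \<Rightarrow> nat \<Rightarrow> nat \<Rightarrow> (nat \<Rightarrow> real vec) set" where
  "coloop_tuples d K i = {C \<in> tuples d d. tuple_dep d d C \<and> \<not> small_rel d d K C
    \<and> (\<forall>\<alpha>. tuple_rel d d C \<alpha> \<longrightarrow> \<alpha> i = 0)}"

lemma tuple_rel_permute:
  assumes "p permutes {..<n}"
  shows "tuple_rel d n (C \<circ> p) (\<alpha> \<circ> p) \<longleftrightarrow> tuple_rel d n C \<alpha>"
proof -
  have "(\<Sum>j<n. (\<alpha> \<circ> p) j * (C \<circ> p) j $ i) = (\<Sum>j<n. \<alpha> j * C j $ i)" for i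
    using sum.permute[OF assms, of "\<lambda>j. \<alpha> j * C j $ i"] by (simp add: comp_def)
  then show ?thesis by (simp add: tuple_rel_def)
qed

lemma tuple_dep_permute:
  assumes "p permutes {..<n}" "tuple_dep d n C"
  shows "tuple_dep d n (C \<circ> p)"
proof -
  obtain \<alpha> j where \<alpha>: "tuple_rel d n C \<alpha>" "j < n" "\<alpha> j \<noteq> 0" using assms by (auto simp: tuple_dep_def)
  obtain j' where "j' < n" "p j' = j" using permutes_image[OF assms(1)] \<alpha>(2) by (metis imageE lessThan_iff)
  then show ?thesis using tuple_rel_permute[OF assms(1), of d C \<alpha>] \<alpha>
    by (auto simp: tuple_dep_def intro!: exI[of _ "\<alpha> \<circ> p"] exI[of _ j'])
qed

lemma small_rel_permute:
  assumes p: "p permutes {..<n}" and "small_rel d n K C"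
  shows "small_rel d n K (C \<circ> p)"
proof -
  obtain \<alpha> j where \<alpha>: "tuple_rel d n C \<alpha>" "j < n" "\<alpha> j \<noteq> 0" "card {j. j < n \<and> \<alpha> j \<noteq> 0} \<le> K"
    using assms by (auto simp: small_rel_def)
  obtain j' where j': "j' < n" "p j' = j" using permutes_image[OF p] \<alpha>(2) by (metis imageE lessThan_iff)
  have "card {j. j < n \<and> (\<alpha> \<circ> p) j \<noteq> 0} \<le> card {j. j < n \<and> \<alpha> j \<noteq> 0}"
  proof (rule card_inj_on_le[of p])
    show "inj_on p {j. j < n \<and> (\<alpha> \<circ> p) j \<noteq> 0}" using permutes_inj_on[OF p] .
    show "p ` {j. j < n \<and> (\<alpha> \<circ> p) j \<noteq> 0} \<subseteq> {j. j < n \<and> \<alpha> j \<noteq> 0}"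
      using permutes_in_image[OF p] by auto
  qed auto
  then show ?thesis using tuple_rel_permute[OF p, of d C \<alpha>] \<alpha> j'
    by (auto simp: small_rel_def intro!: exI[of _ "\<alpha> \<circ> p"] exI[of _ j'])
qed

text \<open>Swapping the columns \<open>i\<close> and \<open>l\<close> is its own inverse and maps
  the first set into the second.\<close>

lemma card_coloop_tuples_le:
  assumes "i < d" "l < d"
  shows "card (coloop_tuples d K i) \<le> card (coloop_tuples d K l)"
proof (rule card_inj_on_le)
  define p where "p = Transposition.transpose i l"
  have p: "p permutes {..<d}" unfolding p_def using assms by (intro permutes_swap_id) auto
  have pp: "p \<circ> p = id" by (simp add: p_def)
  have Cpp: "C \<circ> p \<circ> p = C" for C :: "nat \<Rightarrow> 'z" using pp by (simp add: comp_assoc)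
  show "inj_on (\<lambda>C. C \<circ> p) (coloop_tuples d K i)"
    by (rule inj_onI) (metis Cpp)
  show "(\<lambda>C. C \<circ> p) ` coloop_tuples d K i \<subseteq> coloop_tuples d K l"
  proof
    fix C' assume "C' \<in> (\<lambda>C. C \<circ> p) ` coloop_tuples d K i"
    then obtain C where C: "C \<in> coloop_tuples d K i" and C': "C' = C \<circ> p" by auto
    have "C' \<in> tuples d d"
      using C permutes_in_image[OF p] permutes_not_in[OF p]
      by (auto simp: coloop_tuples_def tuples_def C' PiE_iff extensional_def)
    moreover have "tuple_dep d d C'"
      using C tuple_dep_permute[OF p] by (simp add: coloop_tuples_def C')
    moreover have "\<not> small_rel d d K C'"
      using C small_rel_permute[OF p, of d K C'] by (auto simp: coloop_tuples_def C' Cpp)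
    moreover have "\<alpha> l = 0" if "tuple_rel d d C' \<alpha>" for \<alpha>
    proof -
      have "tuple_rel d d C (\<alpha> \<circ> p)"
        using that tuple_rel_permute[OF p, of d C' \<alpha>] by (simp add: C' Cpp)
      moreover have "\<beta> i = 0" if "tuple_rel d d C \<beta>" for \<beta>
        using C that by (simp add: coloop_tuples_def)
      ultimately have "(\<alpha> \<circ> p) i = 0" by blast
      then show ?thesis by (simp add: p_def)
    qed
    ultimately show "C' \<in> coloop_tuples d K l" by (simp add: coloop_tuples_def)
  qed
  show "finite (coloop_tuples d K l)" by (simp add: coloop_tuples_def)
qed

text \<open>By symmetry the left-hand side counts pairs of a tuple and one of its coloops, and the support of
  a single relation leaves fewer than \<open>d - K\<close> coordinates that can be coloops.\<close>

lemma coloop_tuples_bound: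
  assumes "i < d"
  shows "d * card (coloop_tuples d K i) \<le> (d - K) * card {C \<in> tuples d d. tuple_dep d d C}"
proof -
  define D where "D = {C \<in> tuples d d. tuple_dep d d C \<and> \<not> small_rel d d K C}"
  define cl where "cl C = {l \<in> {..<d}. \<forall>\<alpha>. tuple_rel d d C \<alpha> \<longrightarrow> \<alpha> l = 0}" for C
  have fD: "finite D" by (simp add: D_def)
  have cl: "card (cl C) \<le> d - K" if C: "C \<in> D" for C
  proof -
    obtain \<alpha> j where \<alpha>: "tuple_rel d d C \<alpha>" "j < d" "\<alpha> j \<noteq> 0" using C by (auto simp: D_def tuple_dep_def)
    then have K: "K < card {j. j < d \<and> \<alpha> j \<noteq> 0}" using C by (force simp: D_def small_rel_def)
    have "card (cl C) \<le> card ({..<d} - {j. j < d \<and> \<alpha> j \<noteq> 0})"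
      using \<alpha>(1) by (intro card_mono) (auto simp: cl_def)
    also have "\<dots> = d - card {j. j < d \<and> \<alpha> j \<noteq> 0}"
      by (subst card_Diff_subset) auto
    finally show ?thesis using K by linarith
  qed
  have "d * card (coloop_tuples d K i) = (\<Sum>l<d. card (coloop_tuples d K i))" by simp
  also have "\<dots> \<le> (\<Sum>l<d. card (coloop_tuples d K l))"
    using assms by (intro sum_mono card_coloop_tuples_le) auto
  also have "\<dots> = (\<Sum>l<d. \<Sum>C\<in>D. if \<forall>\<alpha>. tuple_rel d d C \<alpha> \<longrightarrow> \<alpha> l = 0 then 1 else 0)"
  proof (intro sum.cong refl)
    fix l
    have "coloop_tuples d K l = {C \<in> D. \<forall>\<alpha>. tuple_rel d d C \<alpha> \<longrightarrow> \<alpha> l = 0}"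
      by (auto simp: coloop_tuples_def D_def)
    then show "card (coloop_tuples d K l) = (\<Sum>C\<in>D. if \<forall>\<alpha>. tuple_rel d d C \<alpha> \<longrightarrow> \<alpha> l = 0 then 1 else 0)"
      using fD by (simp add: sum.If_cases Int_def)
  qed
  also have "\<dots> = (\<Sum>C\<in>D. \<Sum>l<d. if \<forall>\<alpha>. tuple_rel d d C \<alpha> \<longrightarrow> \<alpha> l = 0 then 1 else 0)"
    by (rule sum.swap)
  also have "\<dots> = (\<Sum>C\<in>D. card (cl C))"
    by (simp add: sum.If_cases Int_def cl_def)
  also have "\<dots> \<le> (\<Sum>C\<in>D. d - K)" by (intro sum_mono cl)
  also have "\<dots> = (d - K) * card D" by simp
  also have "\<dots> \<le> (d - K) * card {C \<in> tuples d d. tuple_dep d d C}"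
    by (intro mult_left_mono card_mono) (auto simp: D_def)
  finally show ?thesis .
qed

text \<open>A counted tuple extends by at least half of all zero-one vectors to one whose last
  position is a coloop. Every relation of the extension vanishes there, so its support is still
  larger than \<open>K\<close> and \<open>coloop_tuples_bound\<close> applies.\<close>

lemma large_support_bound:
  assumes "d \<ge> 1"
  shows "real d * (card {C \<in> tuples d (d - 1). tuple_dep d (d - 1) C \<and> \<not> small_rel d (d - 1) K C} / 2 ^ (d * (d - 1)))
    \<le> 2 * real (d - K) * P_s d"
proof -
  define n where "n = d - 1"
  have d: "d = Suc n" using assms by (simp add: n_def)
  define D where "D = {C \<in> tuples d n. tuple_dep d n C \<and> \<not> small_rel d n K C}"
  have fD: "finite D" by (simp add: D_def)
  \<comment> \<open>Extensions of tuples in \<open>D\<close> by a vector outside their span.\<close>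
  define U where "U = {C \<in> tuples d (Suc n). restrict C {..<n} \<in> D \<and> C n \<notin> tuple_span d n (restrict C {..<n})}"
  have restr: "restrict C {..<n} = C" if "C \<in> tuples d n" for C
    using that by (auto simp: tuples_def PiE_iff extensional_def fun_eq_iff restrict_def)
  have "U \<subseteq> coloop_tuples d K n"
  proof
    fix C assume C: "C \<in> U"
    define C0 where "C0 = restrict C {..<n}"
    define v where "v = C n"
    have C0: "C0 \<in> D" "v \<notin> tuple_span d n C0" "C \<in> tuples d d"
      using C by (auto simp: U_def C0_def v_def d)
    have Cv: "C = C0(n := v)"
      using C0(3) by (auto simp: C0_def v_def d tuples_def fun_eq_iff PiE_iff extensional_def restrict_def)
    have zero: "\<alpha> n = 0" if "tuple_rel d d C \<alpha>" for \<alpha>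
      using tuple_rel_Suc_span[of d n C0 v \<alpha>] that C0(2) by (auto simp: d Cv)
    have "tuple_dep d d C"
      using tuple_dep_Suc[of d n C0 v] C0(1) by (simp add: D_def d Cv)
    moreover have "\<not> small_rel d d K C"
    proof
      assume "small_rel d d K C"
      then obtain \<alpha> j where \<alpha>: "tuple_rel d d C \<alpha>" "j < d" "\<alpha> j \<noteq> 0" "card {j. j < d \<and> \<alpha> j \<noteq> 0} \<le> K"
        by (auto simp: small_rel_def)
      have 0: "\<alpha> n = 0" using zero \<alpha>(1) by blast
      have j: "j < n" using \<alpha>(2,3) 0 d by (metis less_SucE)
      have "tuple_rel d n C0 \<alpha>" using \<alpha>(1) 0 by (simp add: Cv d tuple_rel_def)
      moreover have "{j. j < d \<and> \<alpha> j \<noteq> 0} = {j. j < n \<and> \<alpha> j \<noteq> 0}"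
        using 0 d by (auto simp: less_Suc_eq)
      ultimately have "small_rel d n K C0" using \<alpha> j by (auto simp: small_rel_def)
      then show False using C0(1) by (simp add: D_def)
    qed
    ultimately show "C \<in> coloop_tuples d K n" using C0(3) zero by (simp add: coloop_tuples_def)
  qed
  then have cU: "card U \<le> card (coloop_tuples d K n)"
    by (intro card_mono) (auto simp: coloop_tuples_def)
  have "card U = (\<Sum>C\<in>tuples d n. card {v \<in> zero_one_vecs d. C \<in> D \<and> v \<notin> tuple_span d n C})"
    unfolding U_def card_tuples_Suc_Collect by (intro sum.cong refl) (simp add: restr)
  also have "\<dots> = (\<Sum>C\<in>D. card {v \<in> zero_one_vecs d. C \<in> D \<and> v \<notin> tuple_span d n C})"
    by (rule sum.mono_neutral_right) (auto simp: D_def)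
  finally have cU': "card U = (\<Sum>C\<in>D. card {v \<in> zero_one_vecs d. C \<in> D \<and> v \<notin> tuple_span d n C})" .
  have half: "2 ^ d \<le> 2 * card {v \<in> zero_one_vecs d. C \<in> D \<and> v \<notin> tuple_span d n C}" if "C \<in> D" for C
  proof -
    have "{v \<in> zero_one_vecs d. C \<in> D \<and> v \<notin> tuple_span d n C}
        = zero_one_vecs d - (zero_one_vecs d \<inter> tuple_span d n C)"
      using that by auto
    then have "card {v \<in> zero_one_vecs d. C \<in> D \<and> v \<notin> tuple_span d n C}
        = 2 ^ d - card (zero_one_vecs d \<inter> tuple_span d n C)"
      by (simp add: card_Diff_subset card_zero_one_vecs)
    then show ?thesis using card_zero_one_vecs_tuple_span_le[of n d C] d by linarith
  qed
  have "card D * 2 ^ d = (\<Sum>C\<in>D. 2 ^ d)" by simp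
  also have "\<dots> \<le> (\<Sum>C\<in>D. 2 * card {v \<in> zero_one_vecs d. C \<in> D \<and> v \<notin> tuple_span d n C})"
    by (intro sum_mono half)
  also have "\<dots> = 2 * card U" by (simp add: cU' sum_distrib_left)
  also have "\<dots> \<le> 2 * card (coloop_tuples d K n)" using cU by simp
  finally have "d * (card D * 2 ^ d) \<le> 2 * (d * card (coloop_tuples d K n))"
    by (simp add: mult.left_commute)
  also have "\<dots> \<le> 2 * ((d - K) * card {C \<in> tuples d d. tuple_dep d d C})"
    using coloop_tuples_bound[of n d K] d by (intro mult_left_mono) auto
  finally have "real (d * (card D * 2 ^ d)) \<le> real (2 * ((d - K) * card {C \<in> tuples d d. tuple_dep d d C}))"
    by (rule of_nat_mono)
  then have "real d * (card D * 2 ^ d) / 2 ^ (d * d) \<le> 2 * (real (d - K) * card {C \<in> tuples d d. tuple_dep d d C}) / 2 ^ (d * d)"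
    by (intro divide_right_mono) (auto simp del: of_nat_diff)
  moreover have "(2 :: real) ^ (d * d) = 2 ^ (d * n) * 2 ^ d" by (simp add: d flip: power_add)
  then have "real d * (card D * 2 ^ d) / 2 ^ (d * d) = real d * (card D / 2 ^ (d * n))" by simp
  ultimately show ?thesis by (simp add: P_s_eq D_def n_def mult.assoc)
qed

section \<open>Linear relations with small support\<close>

text \<open>For zero-one vectors this is the existence of a relation with support of size one or
  two; such tuples supply the main term.\<close>

definition degenerate :: "nat \<Rightarrow> nat \<Rightarrow> (nat \<Rightarrow> real vec) \<Rightarrow> bool" where
  "degenerate d n C \<longleftrightarrow> (\<exists>j<n. C j = 0\<^sub>v d) \<or> \<not> inj_on C {..<n}"

lemma degenerate_imp_tuple_dep: "degenerate d n C \<Longrightarrow> tuple_dep d n C"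
  using tuple_dep_if_zero tuple_dep_if_not_inj by (auto simp: degenerate_def)

text \<open>A birthday count: such tuples are the injections into the nonzero vectors, and position
  \<open>j\<close> avoids the zero vector and \<open>j\<close> earlier values.
  \<open>n < 2 ^ d\<close> keeps the natural subtraction exact.\<close>

lemma card_not_degenerate:
  assumes "n < 2 ^ d"
  shows "real (card {C \<in> tuples d n. \<not> degenerate d n C}) / 2 ^ (d * n) = (\<Prod>j<n. 1 - (real j + 1) / 2 ^ d)"
proof -
  have "{C \<in> tuples d n. \<not> degenerate d n C}
      = {C \<in> {..<n} \<rightarrow>\<^sub>E (zero_one_vecs d - {0\<^sub>v d}). inj_on C {..<n}}"
    by (auto simp: tuples_def degenerate_def PiE_iff)
  then have "card {C \<in> tuples d n. \<not> degenerate d n C} = (\<Prod>j<n. 2 ^ d - 1 - j)"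
    using card_inj_on_subset_funcset[of "{..<n}" "zero_one_vecs d - {0\<^sub>v d}" "{..<n}"]
    by (simp add: card_zero_one_vecs zero_vec_in_zero_one_vecs lessThan_atLeast0)
  then have "real (card {C \<in> tuples d n. \<not> degenerate d n C}) / 2 ^ (d * n) = (\<Prod>j<n. real (2 ^ d - 1 - j)) / (\<Prod>j<n. 2 ^ d)"
    by (simp add: power_mult)
  also have "\<dots> = (\<Prod>j<n. real (2 ^ d - 1 - j) / 2 ^ d)" by (rule prod_dividef[symmetric])
  also have "\<dots> = (\<Prod>j<n. 1 - (real j + 1) / 2 ^ d)"
  proof (intro prod.cong refl)
    fix j assume "j \<in> {..<n}"
    then have "j + 1 \<le> 2 ^ d" using assms by simp
    then have "real (2 ^ d - 1 - j) = 2 ^ d - (real j + 1)"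
      using of_nat_diff[of "j + 1" "2 ^ d", where 'a = real] by (simp add: algebra_simps)
    then show "real (2 ^ d - 1 - j) / 2 ^ d = 1 - (real j + 1) / 2 ^ d" by (simp add: diff_divide_distrib)
  qed
  finally show ?thesis .
qed

lemma small_rel_cases:
  assumes C: "C \<in> tuples d n" and "small_rel d n K C"
  shows "degenerate d n C \<or> (\<exists>J\<subseteq>{..<n}. 3 \<le> card J \<and> card J \<le> K \<and>
    (\<exists>\<alpha>. (\<forall>j\<in>J. \<alpha> j \<noteq> 0) \<and> (\<forall>i<d. (\<Sum>j\<in>J. C j $ i * \<alpha> j) = 0)))"
proof -
  obtain \<alpha> j where \<alpha>: "tuple_rel d n C \<alpha>" "j < n" "\<alpha> j \<noteq> 0" "card {j. j < n \<and> \<alpha> j \<noteq> 0} \<le> K"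
    using assms by (auto simp: small_rel_def)
  define J where "J = {j. j < n \<and> \<alpha> j \<noteq> 0}"
  have J: "J \<subseteq> {..<n}" "finite J" "j \<in> J" using \<alpha> by (auto simp: J_def)
  have rel: "(\<Sum>j\<in>J. C j $ i * \<alpha> j) = 0" if "i < d" for i
  proof -
    have "(\<Sum>j\<in>J. C j $ i * \<alpha> j) = (\<Sum>j<n. \<alpha> j * C j $ i)"
      by (intro sum.mono_neutral_cong_left) (auto simp: J_def)
    then show ?thesis using \<alpha>(1) that by (simp add: tuple_rel_def)
  qed
  have entry: "C l $ i \<in> {0, 1}" if "l < n" "i < d" for l i
    using C that by (auto simp: tuples_def PiE_iff zero_one_vecs_def)
  have "card J > 0" using J by (auto simp: card_gt_0_iff)
  then consider "card J = 1" | "card J = 2" | "3 \<le> card J" by linarith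
  then show ?thesis
  proof cases
    case 1
    then have "J = {j}" using J by (metis card_1_singletonE singletonD)
    then have "C j $ i = 0" if "i < d" for i using rel[OF that] \<alpha>(3) by simp
    then have "C j = 0\<^sub>v d" using tuples_carrier[OF C \<alpha>(2)] by (intro eq_vecI) auto
    then show ?thesis using \<alpha>(2) by (auto simp: degenerate_def)
  next
    case 2
    then obtain a b where ab: "J = {a, b}" "a \<noteq> b" by (auto simp: card_2_iff)
    then have *: "a < n" "b < n" "\<alpha> a \<noteq> 0" "\<alpha> b \<noteq> 0" by (auto simp: J_def set_eq_iff)
    \<comment> \<open>An entry 1 facing an entry 0 would force one of the two coefficients to be
      zero.\<close>
    have "C a $ i = C b $ i" if "i < d" for i
      using rel[OF that] entry[OF *(1) that] entry[OF *(2) that] ab * by auto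
    then have "C a = C b"
      using tuples_carrier[OF C *(1)] tuples_carrier[OF C *(2)] by (intro eq_vecI) auto
    then show ?thesis using * ab by (auto simp: degenerate_def inj_on_def)
  next
    case 3
    have "\<forall>j\<in>J. \<alpha> j \<noteq> 0" by (simp add: J_def)
    then show ?thesis using 3 \<alpha>(4) J(1) rel unfolding J_def[symmetric] by blast
  qed
qed

text \<open>Union bound over the supports \<open>J\<close>, grouped by size; sizes one and two are
  excluded because the tuple is not degenerate.\<close>

lemma small_support_bound:
  assumes "K \<le> d"
  shows "card {C \<in> tuples d n. small_rel d n K C \<and> \<not> degenerate d n C} / 2 ^ (d * n)
    \<le> (\<Sum>k\<in>{3..K}. real (n choose k) * real (d choose (k - 1)) * lo_bound k 1 ^ (d - (k - 1)))"
proof -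
  define F where "F J = {C \<in> tuples d n. \<exists>\<alpha>. (\<forall>j\<in>J. \<alpha> j \<noteq> 0) \<and> (\<forall>i<d. (\<Sum>j\<in>J. C j $ i * \<alpha> j) = 0)}" for J
  define \<J> where "\<J> k = {J. J \<subseteq> {..<n} \<and> card J = k}" for k
  have fJ: "finite (\<J> k)" for k by (simp add: \<J>_def)
  have "{C \<in> tuples d n. small_rel d n K C \<and> \<not> degenerate d n C} \<subseteq> (\<Union>k\<in>{3..K}. \<Union>J\<in>\<J> k. F J)"
  proof
    fix C assume "C \<in> {C \<in> tuples d n. small_rel d n K C \<and> \<not> degenerate d n C}"
    then have C: "C \<in> tuples d n" "small_rel d n K C" "\<not> degenerate d n C" by auto
    obtain J where "J \<subseteq> {..<n}" "3 \<le> card J" "card J \<le> K" "C \<in> F J"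
      using small_rel_cases[OF C(1,2)] C(1,3) unfolding F_def by blast
    then have "card J \<in> {3..K}" "J \<in> \<J> (card J)" "C \<in> F J" by (auto simp: \<J>_def)
    then show "C \<in> (\<Union>k\<in>{3..K}. \<Union>J\<in>\<J> k. F J)" by blast
  qed
  then have "card {C \<in> tuples d n. small_rel d n K C \<and> \<not> degenerate d n C} \<le> card (\<Union>k\<in>{3..K}. \<Union>J\<in>\<J> k. F J)"
    using fJ by (intro card_mono) (auto simp: F_def)
  also have "\<dots> \<le> (\<Sum>k\<in>{3..K}. card (\<Union>J\<in>\<J> k. F J))" by (rule card_UN_le) auto
  also have "\<dots> \<le> (\<Sum>k\<in>{3..K}. \<Sum>J\<in>\<J> k. card (F J))" by (intro sum_mono card_UN_le fJ)
  finally have "real (card {C \<in> tuples d n. small_rel d n K C \<and> \<not> degenerate d n C})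
      \<le> (\<Sum>k\<in>{3..K}. \<Sum>J\<in>\<J> k. real (card (F J)))"
    by (simp only: of_nat_le_iff flip: of_nat_sum)
  also have "\<dots> \<le> (\<Sum>k\<in>{3..K}. \<Sum>J\<in>\<J> k. real (d choose (k - 1)) * lo_bound k 1 ^ (d - (k - 1)) * 2 ^ (d * n))"
  proof (intro sum_mono)
    fix k J assume k: "k \<in> {3..K}" "J \<in> \<J> k"
    then have J: "J \<subseteq> {..<n}" "card J = k" by (auto simp: \<J>_def)
    moreover have "J \<noteq> {}" using J k by auto
    moreover have "card J - 1 \<le> d" using J k assms by auto
    ultimately show "real (card (F J)) \<le> real (d choose (k - 1)) * lo_bound k 1 ^ (d - (k - 1)) * 2 ^ (d * n)"
      using card_tuples_support_le[of J n d] by (simp add: F_def)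
  qed
  also have "\<dots> = (\<Sum>k\<in>{3..K}. real (n choose k) * real (d choose (k - 1)) * lo_bound k 1 ^ (d - (k - 1))) * 2 ^ (d * n)"
    unfolding sum_distrib_right by (intro sum.cong refl) (simp add: \<J>_def n_subsets)
  finally show ?thesis by (simp add: divide_le_eq)
qed

section \<open>Asymptotics\<close>

text \<open>One term of the expansion of \<open>(1 + t) ^ n\<close>. A small \<open>t\<close> makes
  this much better than \<open>2 ^ n\<close> when \<open>k\<close> is a small fraction of
  \<open>n\<close>.\<close>

lemma binomial_le_power:
  fixes t :: real
  assumes "0 < t"
  shows "real (n choose k) \<le> (1 + t) ^ n / t ^ k"
proof (cases "k \<le> n")
  case True
  have "real (n choose k) * t ^ k \<le> (\<Sum>i\<le>n. real (n choose i) * t ^ i * 1 ^ (n - i))"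
    using True assms member_le_sum[of k "{..n}" "\<lambda>i. real (n choose i) * t ^ i * 1 ^ (n - i)"] by simp
  also have "\<dots> = (1 + t) ^ n" using binomial_ring[of t 1 n] by (simp add: add.commute)
  finally show ?thesis using assms by (simp add: pos_le_divide_eq)
next
  case False
  then show ?thesis using assms by (simp add: binomial_eq_0)
qed

text \<open>The term for size \<open>k\<close> in \<open>small_support_bound\<close> at
  \<open>n = d - 1\<close>.\<close>

definition support_bound :: "nat \<Rightarrow> nat \<Rightarrow> real" where
  "support_bound d k = real ((d - 1) choose k) * real (d choose (k - 1)) * lo_bound k 1 ^ (d - (k - 1))"

text \<open>The base of the power only matters in being below \<open>1 / 2\<close>; it is
  \<open>(21 / 20)\<^sup>2 * (3 / 8) * (6 / 5)\<close>.\<close>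

lemma support_bound_few:
  assumes k: "3 \<le> k" "50 * k \<le> d"
  shows "support_bound d k \<le> (3969 / 8000) ^ d"
proof -
  have "real ((d - 1) choose k) \<le> real (d choose k)"
    by (simp add: binomial_right_mono)
  also have "\<dots> \<le> (21 / 20) ^ d * 20 ^ k"
    using binomial_le_power[of "1 / 20" d k] by (simp add: power_divide)
  finally have 1: "real ((d - 1) choose k) \<le> (21 / 20) ^ d * 20 ^ k" .
  have "real (d choose (k - 1)) \<le> (21 / 20) ^ d * 20 ^ (k - 1)"
    using binomial_le_power[of "1 / 20" d "k - 1"] by (simp add: power_divide)
  also have "\<dots> \<le> (21 / 20) ^ d * 20 ^ k" by (intro mult_left_mono power_increasing) auto
  finally have 2: "real (d choose (k - 1)) \<le> (21 / 20) ^ d * 20 ^ k" .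
  have "lo_bound k 1 ^ (d - (k - 1)) \<le> (3 / 8) ^ (d - (k - 1))"
    using lo_bound_antimono[OF k(1), of 1] lo_bound_3_1 by (intro power_mono) (auto simp: lo_bound_nonneg)
  also have "\<dots> \<le> (3 / 8) ^ (d - k)" by (intro power_decreasing) auto
  also have "\<dots> = (3 / 8) ^ d * (8 / 3) ^ k" using k by (simp add: power_diff power_divide field_simps)
  finally have 3: "lo_bound k 1 ^ (d - (k - 1)) \<le> (3 / 8) ^ d * (8 / 3) ^ k" .
  have "support_bound d k \<le> ((21 / 20) ^ d * 20 ^ k) * ((21 / 20) ^ d * 20 ^ k) * ((3 / 8) ^ d * (8 / 3) ^ k)"
    unfolding support_bound_def by (intro mult_mono 1 2 3) (auto simp: lo_bound_nonneg)
  also have "\<dots> = (21 / 20 * (21 / 20) * (3 / 8)) ^ d * (20 * 20 * (8 / 3)) ^ k"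
    by (simp only: power_mult_distrib mult_ac)
  also have "\<dots> \<le> (21 / 20 * (21 / 20) * (3 / 8)) ^ d * (6 / 5) ^ d"
  proof (intro mult_left_mono)
    \<comment> \<open>The ratio 50 between \<open>d\<close> and \<open>k\<close> is large enough for
      \<open>(6 / 5) ^ 50\<close> to exceed \<open>20 * 20 * (8 / 3)\<close>.\<close>
    have "(20 * 20 * (8 / 3)) ^ k \<le> ((6 / 5) ^ 50 :: real) ^ k"
      by (intro power_mono) (auto simp: power_divide)
    also have "\<dots> = (6 / 5) ^ (50 * k)" by (simp only: power_mult)
    also have "\<dots> \<le> (6 / 5) ^ d" using k by (intro power_increasing) auto
    finally show "(20 * 20 * (8 / 3)) ^ k \<le> (6 / 5 :: real) ^ d" .
  qed auto
  also have "\<dots> = (3969 / 8000) ^ d" by (simp flip: power_mult_distrib)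
  finally show ?thesis .
qed

text \<open>Both binomials are at most \<open>2 ^ d\<close>. Since \<open>k\<close> stays below
  \<open>d\<close> by \<open>d div m\<close>, the exponent is at least \<open>d / m\<close>, so the
  power is at most \<open>(1 / 12) ^ d\<close>; the base \<open>1 / 12\<close> is chosen to give
  \<open>4 / 12 = 1 / 3\<close>, below \<open>1 / 2\<close>.\<close>

lemma support_bound_many:
  assumes k: "lo_bound k 1 \<le> (1 / 12) ^ m" "1 \<le> k" "k \<le> d - d div m" "m > 0"
  shows "support_bound d k \<le> (1 / 3) ^ d"
proof -
  have 1: "real ((d - 1) choose k) \<le> 2 ^ d"
  proof -
    have "(d - 1) choose k \<le> 2 ^ (d - 1)" by (rule binomial_le_pow2)
    also have "\<dots> \<le> 2 ^ d" by (intro power_increasing) auto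
    finally show ?thesis by (metis of_nat_le_iff of_nat_numeral of_nat_power)
  qed
  have 2: "real (d choose (k - 1)) \<le> 2 ^ d"
    using binomial_le_pow2[of d "k - 1"] by (metis of_nat_le_iff of_nat_numeral of_nat_power)
  have "d div m \<le> d" by simp
  \<comment> \<open>The extra 1 from \<open>k - 1\<close> makes up for the rounding in
    \<open>d div m\<close>.\<close>
  then have "d div m + 1 \<le> d - (k - 1)" using k by linarith
  then have "m * (d div m + 1) \<le> m * (d - (k - 1))" by (rule mult_left_mono) auto
  moreover have "d \<le> m * (d div m + 1)"
    using k(4) by (metis Suc_eq_plus1 dividend_less_times_div less_imp_le mult_Suc_right add.commute)
  ultimately have e: "d \<le> m * (d - (k - 1))" by linarith
  have "lo_bound k 1 ^ (d - (k - 1)) \<le> ((1 / 12) ^ m) ^ (d - (k - 1))"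
    by (intro power_mono k lo_bound_nonneg)
  also have "\<dots> = (1 / 12) ^ (m * (d - (k - 1)))" by (simp only: power_mult)
  also have "\<dots> \<le> (1 / 12) ^ d" using e by (intro power_decreasing) auto
  finally have 3: "lo_bound k 1 ^ (d - (k - 1)) \<le> (1 / 12) ^ d" .
  have "support_bound d k \<le> 2 ^ d * 2 ^ d * (1 / 12) ^ d"
    unfolding support_bound_def by (intro mult_mono 1 2 3) (auto simp: lo_bound_nonneg)
  also have "\<dots> = (1 / 3) ^ d" by (simp flip: power_mult_distrib)
  finally show ?thesis .
qed

lemma eventually_sum_support_bound_le:
  assumes "m > 0"
  shows "\<forall>\<^sub>F d in sequentially. (\<Sum>k\<in>{3..d - d div m}. support_bound d k) \<le> real d * (3969 / 8000) ^ d"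
proof -
  have "\<forall>\<^sub>F k in sequentially. lo_bound k 1 < (1 / 12) ^ m"
    by (rule order_tendstoD(2)[OF lo_bound_tendsto_0]) simp
  then obtain k0 where k0: "\<And>k. k \<ge> k0 \<Longrightarrow> lo_bound k 1 \<le> (1 / 12) ^ m"
    by (auto simp: eventually_sequentially intro: less_imp_le)
  show ?thesis
    \<comment> \<open>Then every \<open>k\<close> with \<open>50 * k > d\<close> exceeds
      \<open>k0\<close>, so each \<open>k\<close> falls under one of the two estimates.\<close>
    using eventually_ge_at_top[of "50 * k0"]
  proof eventually_elim
    case (elim d)
    have "support_bound d k \<le> (3969 / 8000) ^ d" if k: "k \<in> {3..d - d div m}" for k
    proof (cases "50 * k \<le> d")
      case True
      then show ?thesis using k support_bound_few by simp
    next
      case False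
      then have "support_bound d k \<le> (1 / 3) ^ d"
        using k elim assms by (intro support_bound_many[of k m] k0) auto
      also have "\<dots> \<le> (3969 / 8000) ^ d" by (intro power_mono) auto
      finally show ?thesis .
    qed
    then have "(\<Sum>k\<in>{3..d - d div m}. support_bound d k) \<le> (\<Sum>k\<in>{3..d - d div m}. (3969 / 8000) ^ d)"
      by (rule sum_mono)
    also have "\<dots> \<le> real d * (3969 / 8000) ^ d"
      by simp
    finally show ?case .
  qed
qed

section \<open>The probability of a zero column or of two equal columns\<close>

definition degenerate_prob :: "nat \<Rightarrow> real" where
  "degenerate_prob d = card {C \<in> tuples d (d - 1). degenerate d (d - 1) C} / 2 ^ (d * (d - 1))"

lemma degenerate_prob_eq:
  assumes "d \<ge> 1"
  shows "degenerate_prob d = 1 - (\<Prod>j<d - 1. 1 - (real j + 1) / 2 ^ d)"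
proof -
  define n where "n = d - 1"
  have n: "n < 2 ^ d" using less_exp[of d] unfolding n_def by linarith
  define A where "A = {C \<in> tuples d n. degenerate d n C}"
  define B where "B = {C \<in> tuples d n. \<not> degenerate d n C}"
  have "tuples d n = A \<union> B" "A \<inter> B = {}" "finite A" "finite B" by (auto simp: A_def B_def)
  then have "real (card A) + real (card B) = 2 ^ (d * n)"
    using card_Un_disjoint[of A B] card_tuples[of d n]
    by (metis of_nat_add of_nat_numeral of_nat_power)
  then have "card A / 2 ^ (d * n) = 1 - card B / 2 ^ (d * n)" by (simp add: field_simps)
  then show ?thesis
    using card_not_degenerate[OF n] by (simp add: degenerate_prob_def A_def B_def n_def)
qed

lemma sum_Suc_eq: "(\<Sum>j<n. real j + 1) = real n * (real n + 1) / 2"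
  by (induction n) (auto simp: field_simps)

text \<open>Here \<open>s\<close> is the sum of the terms subtracted in the product. The upper bound
  is the Weierstrass product inequality; the lower one uses \<open>1 - f j \<le> exp (- f j)\<close>
  and \<open>exp s \<ge> 1 + s\<close>.\<close>

lemma degenerate_prob_bounds:
  assumes "d \<ge> 1"
  defines "s \<equiv> real d * (real d - 1) / 2 ^ (d + 1)"
  shows "degenerate_prob d \<le> s" and "s / (1 + s) \<le> degenerate_prob d"
proof -
  define f where "f j = (real j + 1) / 2 ^ d" for j :: nat
  have s: "(\<Sum>j<d - 1. f j) = s"
    using assms(1) by (simp add: f_def s_def sum_Suc_eq of_nat_diff flip: sum_divide_distrib)
  have s0: "0 \<le> s" using assms(1) by (simp add: s_def)
  have f: "f j \<in> {0..1}" if "j \<in> {..<d - 1}" for j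
  proof -
    have "j + 1 \<le> d" using that by simp
    then have "j + 1 \<le> 2 ^ d" using less_exp[of d] by linarith
    then have "real (j + 1) \<le> 2 ^ d" by (metis of_nat_le_iff of_nat_numeral of_nat_power)
    then show ?thesis by (simp add: f_def divide_le_eq)
  qed
  have eq: "degenerate_prob d = 1 - (\<Prod>j<d - 1. 1 - f j)"
    using degenerate_prob_eq[OF assms(1)] by (simp add: f_def)
  show "degenerate_prob d \<le> s"
    using Weierstrass_prod_ineq[of "{..<d - 1}" f, OF f] s unfolding eq by linarith
  have "(\<Prod>j<d - 1. 1 - f j) \<le> (\<Prod>j<d - 1. exp (- f j))"
  proof (rule prod_mono)
    fix j assume "j \<in> {..<d - 1}"
    then show "0 \<le> 1 - f j \<and> 1 - f j \<le> exp (- f j)"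
      using f[of j] exp_ge_add_one_self[of "- f j"] by simp
  qed
  also have "\<dots> = exp (\<Sum>j<d - 1. - f j)" by (rule exp_sum[symmetric]) simp
  also have "\<dots> = inverse (exp s)" unfolding sum_negf s by (rule exp_minus)
  also have "\<dots> \<le> inverse (1 + s)" using s0 by (intro le_imp_inverse_le) (auto intro: exp_ge_add_one_self)
  finally have "1 - inverse (1 + s) \<le> degenerate_prob d" by (simp add: eq)
  also have "1 - inverse (1 + s) = s / (1 + s)" using s0 by (simp add: field_simps)
  finally show "s / (1 + s) \<le> degenerate_prob d" .
qed

lemma degenerate_prob_le_dep_prob: "degenerate_prob d \<le> dep_prob d"
  unfolding degenerate_prob_def dep_prob_def
  by (intro divide_right_mono of_nat_mono card_mono) (auto intro: degenerate_imp_tuple_dep)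

text \<open>Dependent tuples are split into degenerate ones, others with a relation of support at
  most \<open>d - d div m\<close>, and those with only larger supports. Here \<open>1 / m\<close>
  plays the role of \<open>\<delta>\<close>; the factor 2 is the loss in extending by a vector
  outside the span.\<close>

lemma dep_prob_le:
  assumes "d \<ge> 1" "m > 0"
  shows "dep_prob d \<le> degenerate_prob d + (\<Sum>k\<in>{3..d - d div m}. support_bound d k) + 2 / real m * P_s d"
proof -
  define n K N where "n = d - 1" and "K = d - d div m" and "N = (2 :: real) ^ (d * n)"
  define D S L where "D = {C \<in> tuples d n. degenerate d n C}"
    and "S = {C \<in> tuples d n. small_rel d n K C \<and> \<not> degenerate d n C}"
    and "L = {C \<in> tuples d n. tuple_dep d n C \<and> \<not> small_rel d n K C}"
  have "card {C \<in> tuples d n. tuple_dep d n C} \<le> card (D \<union> S \<union> L)"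
    by (intro card_mono) (auto simp: D_def S_def L_def)
  also have "\<dots> \<le> card D + card S + card L"
    using card_Un_le[of "D \<union> S" L] card_Un_le[of D S] by linarith
  finally have "real (card {C \<in> tuples d n. tuple_dep d n C}) \<le> real (card D + card S + card L)"
    by (rule of_nat_mono)
  then have "dep_prob d \<le> (real (card D + card S + card L)) / N"
    by (simp add: dep_prob_def n_def N_def divide_right_mono)
  also have "\<dots> = degenerate_prob d + card S / N + card L / N"
    by (simp add: degenerate_prob_def D_def n_def N_def add_divide_distrib)
  also have "card S / N \<le> (\<Sum>k\<in>{3..K}. support_bound d k)"
    unfolding S_def N_def support_bound_def n_def by (rule small_support_bound) (simp add: K_def)
  also have "card L / N \<le> 2 / real m * P_s d"
  proof -
    have Ps: "0 \<le> P_s d" by (simp add: P_s_def)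
    have "real (d div m) \<le> real d / real m" by (rule of_nat_div_le_of_nat)
    then have dK: "real (d - K) \<le> real d / real m" by (simp add: K_def)
    have "real d * (card L / N) \<le> 2 * real (d - K) * P_s d"
      using large_support_bound[OF assms(1), of K] by (simp add: L_def N_def n_def)
    also have "\<dots> \<le> 2 * (real d / real m) * P_s d"
      using dK Ps by (intro mult_right_mono mult_left_mono) auto
    also have "\<dots> = real d * (2 / real m * P_s d)" by simp
    finally show ?thesis by (rule mult_left_le_imp_le) (use assms(1) in simp)
  qed
  finally show ?thesis by (simp add: K_def)
qed

section \<open>Assembling the asymptotic formula\<close>

theorem theorem1:
  shows "(\<lambda>d. P_s d / (1 / 2 ^ d * expected_spanned d + real d ^ 2 / 2 ^ (d + 1))) \<longlonglongrightarrow> 1"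
proof (rule LIMSEQ_I)
  define x e where "x d = real d ^ 2 / 2 ^ (d + 1)" and "e d = expected_spanned d / 2 ^ d" for d :: nat
  fix \<epsilon> :: real assume \<epsilon>: "\<epsilon> > 0"
  obtain m0 :: nat where m0: "5 / \<epsilon> < real m0" using reals_Archimedean2 by blast
  \<comment> \<open>The final relative error is at most \<open>5 / m\<close>; the minimum 6 makes
    \<open>u = 1 / m\<close> small enough for the division by \<open>1 - 2 * u\<close>
    below.\<close>
  define m where "m = max m0 6"
  have m: "m \<ge> 6" "5 / real m < \<epsilon>"
  proof -
    have "5 / \<epsilon> < real m" using m0 by (simp add: m_def max_def)
    then show "5 / real m < \<epsilon>" using \<epsilon> by (simp add: m_def field_simps)
  qed (simp add: m_def)
  \<comment> \<open>The supports of intermediate size are negligible against the main term because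
    \<open>3969 / 8000 < 1 / 2\<close>.\<close>
  have "((\<lambda>d. real d * (3969 / 8000) ^ d / (real d ^ 2 / 2 ^ (d + 1))) \<longlongrightarrow> 0) sequentially"
  proof (rule Lim_transform_eventually)
    show "((\<lambda>d. 2 * (3969 / 4000) ^ d / real d) \<longlongrightarrow> 0) sequentially" by real_asymp
    show "\<forall>\<^sub>F d in sequentially. 2 * (3969 / 4000) ^ d / real d
        = real d * (3969 / 8000) ^ d / (real d ^ 2 / 2 ^ (d + 1))"
      using eventually_gt_at_top[of 0]
    proof eventually_elim
      case (elim d)
      have "(3969 / 4000 :: real) ^ d = (3969 / 8000) ^ d * 2 ^ d" by (simp flip: power_mult_distrib)
      then show ?case using elim by (simp add: power2_eq_square)
    qed
  qed
  then have "\<forall>\<^sub>F d in sequentially. real d * (3969 / 8000) ^ d / (real d ^ 2 / 2 ^ (d + 1)) < 1 / real m"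
    by (rule order_tendstoD) (use m in auto)
  moreover have "((\<lambda>d. real d * (real d - 1) / 2 ^ (d + 1) / (1 + real d * (real d - 1) / 2 ^ (d + 1))
      / (real d ^ 2 / 2 ^ (d + 1))) \<longlongrightarrow> 1) sequentially"
    by real_asymp
  then have "\<forall>\<^sub>F d in sequentially. 1 - 1 / real m < real d * (real d - 1) / 2 ^ (d + 1) / (1 + real d * (real d - 1) / 2 ^ (d + 1))
      / (real d ^ 2 / 2 ^ (d + 1))"
    by (rule order_tendstoD) (use m in auto)
  moreover have "((\<lambda>d. real d ^ 2 / 2 ^ (d + 1)) \<longlongrightarrow> 0) sequentially" by real_asymp
  then have "\<forall>\<^sub>F d in sequentially. real d ^ 2 / 2 ^ (d + 1) < 1 / (2 * real m)"
    by (rule order_tendstoD) (use m in auto)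
  moreover have "\<forall>\<^sub>F d in sequentially. (\<Sum>k\<in>{3..d - d div m}. support_bound d k) \<le> real d * (3969 / 8000) ^ d"
    by (rule eventually_sum_support_bound_le) (use m in auto)
  ultimately have "\<forall>\<^sub>F d in sequentially. norm (P_s d / (1 / 2 ^ d * expected_spanned d + real d ^ 2 / 2 ^ (d + 1)) - 1) < \<epsilon>"
    using eventually_ge_at_top[of 1]
  proof eventually_elim
    case (elim d)
    define p P where "p = dep_prob d" and "P = P_s d"
    have x: "x d > 0" using elim(5) by (simp add: x_def)
    have e: "e d \<ge> 0" by (simp add: e_def expected_spanned_def sum_nonneg)
    have P: "0 \<le> P" "P \<le> 1" by (auto simp: P_def P_s_def)
    have split: "P = p + (1 - p) * e d"
      using P_s_decomposition[OF elim(5)] by (simp add: P_def p_def e_def)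
    have p0: "0 \<le> p" by (simp add: p_def dep_prob_def)
    have "real d * (3969 / 8000) ^ d < 1 / real m * x d"
      using elim(1) x by (simp only: x_def pos_divide_less_eq)
    moreover have "degenerate_prob d \<le> x d"
    proof -
      have "real d * (real d - 1) / 2 ^ (d + 1) \<le> x d"
        unfolding x_def by (intro divide_right_mono) (auto simp: power2_eq_square algebra_simps)
      then show ?thesis using degenerate_prob_bounds(1)[OF elim(5)] by linarith
    qed
    ultimately have p_upper: "p \<le> x d + 1 / real m * x d + 2 / real m * P"
      using dep_prob_le[of d m] elim(4,5) m by (simp add: p_def P_def)
    have "(1 - 1 / real m) * x d < real d * (real d - 1) / 2 ^ (d + 1) / (1 + real d * (real d - 1) / 2 ^ (d + 1))"
      using elim(2) x by (simp only: x_def pos_less_divide_eq)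
    then have p_lower: "(1 - 1 / real m) * x d \<le> p"
      using degenerate_prob_bounds(2)[OF elim(5)] degenerate_prob_le_dep_prob[of d] by (simp add: p_def)
    define u where "u = 1 / real m"
    have u: "0 < u" "u \<le> 1 / 6" using m by (auto simp: u_def field_simps)
    have pu: "p \<le> x d + u * x d + 2 * u * P" "(1 - u) * x d \<le> p" "2 * x d < u" "5 * u < \<epsilon>"
      using p_upper p_lower elim(3) m by (auto simp: u_def x_def)
    have "u * P \<le> u" "u * x d \<le> x d" using P u x by (auto simp: mult_left_le mult_left_le_one_le)
    \<comment> \<open>The first two terms of the bound on \<open>p\<close> are together at most
      \<open>2 * x d < u\<close>, and the third is at most \<open>2 * u\<close>.\<close>
    then have p3: "p \<le> 3 * u" using pu by linarith
    have t: "0 < x d + e d" using x e by simp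
    have "(1 - 3 * u) * (x d + e d) \<le> P"
    proof -
      have "(1 - 3 * u) * x d \<le> (1 - u) * x d" using u x by (intro mult_right_mono) auto
      moreover have "(1 - 3 * u) * e d \<le> (1 - p) * e d" using p3 e by (intro mult_right_mono) auto
      ultimately show ?thesis using pu(2) split by (simp add: distrib_left)
    qed
    moreover have "P \<le> (1 + 5 * u) * (x d + e d)"
    proof -
      have "P \<le> p + e d" using split mult_nonneg_nonneg[OF p0 e] by (simp add: algebra_simps)
      \<comment> \<open>The bound on \<open>p\<close> contains \<open>P\<close> itself, from the
        coloop estimate; that term is absorbed on the left.\<close>
      then have "P * (1 - 2 * u) \<le> (1 + u) * x d + e d" using pu(1) by (simp add: algebra_simps)
      also have "\<dots> \<le> (1 + u) * (x d + e d)" using u e by (simp add: algebra_simps)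
      \<comment> \<open>Expanding the product leaves \<open>10 * u * u \<le> 2 * u\<close>, which
        holds for \<open>u \<le> 1 / 5\<close>.\<close>
      also have "\<dots> \<le> ((1 + 5 * u) * (1 - 2 * u)) * (x d + e d)"
      proof (intro mult_right_mono)
        have "u * u \<le> u * (1 / 5)" using u by (intro mult_left_mono) auto
        then show "1 + u \<le> (1 + 5 * u) * (1 - 2 * u)" by (simp add: algebra_simps)
      qed (use t in simp)
      finally have "P * (1 - 2 * u) \<le> ((1 + 5 * u) * (x d + e d)) * (1 - 2 * u)" by (simp add: mult_ac)
      then show ?thesis using u by (simp add: mult_le_cancel_right)
    qed
    ultimately have "1 - 3 * u \<le> P / (x d + e d)" "P / (x d + e d) \<le> 1 + 5 * u"
      using t by (simp_all add: pos_le_divide_eq pos_divide_le_eq)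
    then have "\<bar>P / (x d + e d) - 1\<bar> < \<epsilon>" using pu(4) u by linarith
    moreover have "1 / 2 ^ d * expected_spanned d + real d ^ 2 / 2 ^ (d + 1) = x d + e d"
      by (simp add: x_def e_def)
    ultimately show ?case by (simp add: P_def)
  qed
  then show "\<exists>no. \<forall>d\<ge>no. norm (P_s d / (1 / 2 ^ d * expected_spanned d + real d ^ 2 / 2 ^ (d + 1)) - 1) < \<epsilon>"
    by (simp add: eventually_sequentially)
qed

end
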